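(* Let $n\ge 2$ and $H\ge 1$ be integers and let $p$ be the smallest prime divisor of $n$. Then there are constants $c_n,C_n>0$ depending only on $n$ such that $c_n H^{1+n/p}\le I^*_n(H)\le C_n H^{1+n/p}$.
   Context: A polynomial $f\in\mathbb{C}[X]$ is degenerate if it has two distinct roots whose quotient is a root of unity. $S^*_n(H)$ is the set of polynomials $a_0X^n+\dots+a_n\in\mathbb{Z}[X]$ with $a_0\ne0$, degenerate, and $|a_j|\le H$ for $j=0,\dots,n$. A polynomial in $\mathbb{Z}[X]$ is called irreducible if it is irreducible in $\mathbb{Q}[X]$. $I^*_n(H)$ is the number of irreducible polynomials in $S^*_n(H)$.
   Formalization: The lower bound is not claimed when H = 1 and n is an odd prime, because then I*_n(1) = 0 and the bound fails; the upper bound still covers this case. *)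

theory Defs
  imports Complex_Main
    "HOL-Computational_Algebra.Primes"
    "HOL-Computational_Algebra.Polynomial_Factorial"
begin

definition degenerate :: "complex poly \<Rightarrow> bool" where
  "degenerate f \<longleftrightarrow>
     (\<exists>x y. poly f x = 0 \<and> poly f y = 0 \<and> x \<noteq> y \<and> y \<noteq> 0 \<and> (\<exists>k>0. (x / y) ^ k = 1))"

text \<open>
  In \<open>coeff f j\<close> the index is the exponent, so \<open>coeff f (n - j)\<close> is the coefficient
  written \<open>a\<^sub>j\<close> in \<open>a\<^sub>0 X\<^sup>n + \<dots> + a\<^sub>n\<close>.
\<close>

definition S_star :: "nat \<Rightarrow> nat \<Rightarrow> int poly set" where
  "S_star n H =
     {f. degree f = n \<and> coeff f n \<noteq> 0 \<and> degenerate (map_poly of_int f) \<and>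
         (\<forall>j\<le>n. \<bar>coeff f j\<bar> \<le> int H)}"

text \<open>Irreducibility is over the rationals, so non-primitive integer polynomials may count.\<close>

definition irreducible_over_rat :: "int poly \<Rightarrow> bool" where
  "irreducible_over_rat f \<longleftrightarrow> irreducible (map_poly of_int f :: rat poly)"

definition I_star :: "nat \<Rightarrow> nat \<Rightarrow> nat" where
  "I_star n H = card {f \<in> S_star n H. irreducible_over_rat f}"

text \<open>The set counted by \<^const>\<open>I_star\<close> is finite, so \<^const>\<open>card\<close> is its true size.\<close>

lemma finite_S_star: "finite (S_star n H)"
proof (rule finite_subset)
  let ?L = "{xs. set xs \<subseteq> {- int H..int H} \<and> length xs = Suc n}"
  show "finite (Poly ` ?L)"
    by (intro finite_imageI finite_lists_length_eq) simp
  show "S_star n H \<subseteq> Poly ` ?L"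
  proof
    fix f assume f: "f \<in> S_star n H"
    have "f = Poly (map (coeff f) [0..<Suc n])"
      using f by (intro poly_eqI)
        (auto simp: S_star_def coeff_Poly_eq nth_default_def coeff_eq_0 simp del: upt_Suc)
    moreover have "map (coeff f) [0..<Suc n] \<in> ?L"
      using f by (auto simp: S_star_def abs_le_iff simp del: upt_Suc)
        (smt (verit) less_Suc_eq_le)+
    ultimately show "f \<in> Poly ` ?L" by blast
  qed
qed

end

theory Submission
  imports Defs "Jordan_Normal_Form.Char_Poly" "Berlekamp_Zassenhaus.Factor_Bound"
begin

text \<open>
  Upper bound. Call two roots of an irreducible degenerate \<open>f\<close> equivalent if their quotient is a root
  of unity. Conjugation permutes the equivalence classes transitively, so they all have the same
  size \<open>l \<ge> 2\<close>, where \<open>l\<close> divides \<open>n\<close>. With \<open>a\<close> the leading coefficient of \<open>f\<close>, the polynomial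
  \<open>h = a \<Prod>\<^sub>C (X - \<Prod>C)\<close>, the product being over the classes \<open>C\<close>, is fixed by conjugation and its
  coefficients are sums of numbers \<open>a \<Prod>T\<close> with \<open>T\<close> a set of roots. These are algebraic integers
  bounded by the Mahler measure of \<open>f\<close>, so \<open>h\<close> is an integer polynomial of degree \<open>n/l \<le> n/p\<close> and
  height \<open>O(H)\<close>. Conversely \<open>h\<close> determines \<open>f\<close> up to boundedly many choices: for \<open>x \<in> C\<close> the number
  \<open>\<Prod>C\<close> is \<open>x\<^sup>l\<close> times roots of unity of bounded order, and \<open>f\<close> is determined by \<open>a\<close> and \<open>x\<close>.

  Lower bound. Polynomials in \<open>X\<^sup>p\<close> are degenerate, and prescribing congruences modulo \<open>4\<close> for their
  \<open>n/p + 1\<close> coefficients makes them Eisenstein at \<open>2\<close>. For \<open>H = 1\<close> a single polynomial is enough: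
  \<open>X\<^sup>2 + 1\<close>, or \<open>X\<^sup>n - X\<^sup>p - 1\<close> if \<open>n\<close> is composite.
\<close>

text \<open>The case \<open>H = 1\<close> with \<open>n\<close> an odd prime is excluded from the
  lower bound because there \<open>I_star n 1 = 0\<close>. An irreducible degenerate polynomial
  would have a single class of roots, so all roots would have the same modulus; its leading and
  constant coefficients would be 1 or -1, so this modulus would be 1; and a real root, which exists
  in odd degree, would then be 1 or -1. The exponent counts the at most \<open>n div p + 1\<close>
  coefficients of \<open>h\<close>, each of which has \<open>O(H)\<close> possible values. This
  requires a height bound linear in \<open>H\<close>, whence the Mahler measure: estimating the
  coefficients of \<open>h\<close> as polynomial expressions in those of \<open>f\<close> would cost
  higher powers of \<open>H\<close>. The leading coefficient \<open>a\<close> of \<open>h\<close>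
  also records the scale of \<open>f\<close>, which need not be primitive. Conjugations are
  homomorphisms on all algebraic numbers at once, not elements of the Galois group of one splitting
  field. What matters is that they connect any two roots of an irreducible polynomial and that only
  rational numbers are fixed by all of them.\<close>

hide_const (open) up_ring.coeff up_ring.monom module.smult Coset.order

section \<open>Algebraic integers\<close>

interpretation int_span: Modules.module "\<lambda>(c::int) (x::complex). of_int c * x"
  by unfold_locales (auto simp: algebra_simps)

text \<open>
  Subrings that are finitely generated as abelian groups. Multiplication by an element is an integer
  matrix, whose characteristic polynomial shows that the element is an algebraic integer.
\<close>

definition fg_subring :: "complex set \<Rightarrow> bool" where
  "fg_subring W \<longleftrightarrow> 1 \<in> W \<and> (\<forall>x\<in>W. \<forall>y\<in>W. x * y \<in> W) \<and> (\<exists>B. finite B \<and> W = int_span.span B)"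

lemma fg_subring_subspace: "fg_subring W \<Longrightarrow> int_span.subspace W"
  by (auto simp: fg_subring_def)

lemma fg_subring_ring:
  assumes "fg_subring W"
  shows "0 \<in> W" "1 \<in> W" "x \<in> W \<Longrightarrow> y \<in> W \<Longrightarrow> x + y \<in> W" "x \<in> W \<Longrightarrow> y \<in> W \<Longrightarrow> x * y \<in> W"
    "x \<in> W \<Longrightarrow> - x \<in> W" "of_int c \<in> W"
proof -
  note s = fg_subring_subspace[OF assms]
  show "0 \<in> W" by (rule int_span.subspace_0[OF s])
  show "x \<in> W \<Longrightarrow> y \<in> W \<Longrightarrow> x + y \<in> W" by (rule int_span.subspace_add[OF s])
  show "x \<in> W \<Longrightarrow> - x \<in> W" by (rule int_span.subspace_neg[OF s])
  show "1 \<in> W" "x \<in> W \<Longrightarrow> y \<in> W \<Longrightarrow> x * y \<in> W" using assms by (auto simp: fg_subring_def)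
  then show "of_int c \<in> W" using int_span.subspace_scale[OF s, of 1 c] by auto
qed

lemma fg_subring_sum:
  assumes "fg_subring W" "\<And>i. i \<in> A \<Longrightarrow> f i \<in> W"
  shows "sum f A \<in> W"
  using assms(2) by (induction A rule: infinite_finite_induct) (simp_all add: fg_subring_ring[OF assms(1)])

lemma fg_subring_imp_algebraic_int:
  assumes W: "fg_subring W" and x: "x \<in> W"
  shows "algebraic_int x"
proof -
  obtain B where B: "finite B" "W = int_span.span B" using W by (auto simp: fg_subring_def)
  obtain bs where bs: "set bs = B" "distinct bs" using finite_distinct_list[OF B(1)] by blast
  define k where "k = length bs"
  have "\<exists>u::complex \<Rightarrow> int. x * b = (\<Sum>v\<in>B. of_int (u v) * v)" if "b \<in> B" for b
  proof -
    have "b \<in> W" using that B int_span.span_base by blast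
    then have "x * b \<in> int_span.span B" using fg_subring_ring(4)[OF W] x B by auto
    then show ?thesis unfolding int_span.span_finite[OF B(1)] by auto
  qed
  then obtain u :: "complex \<Rightarrow> complex \<Rightarrow> int" where u: "\<And>b. b \<in> B \<Longrightarrow> x * b = (\<Sum>v\<in>B. of_int (u b v) * v)"
    by metis
  \<comment> \<open>The generators need not be independent, so \<open>A\<close> depends on a choice
    of coordinates \<open>u\<close>; all that matters is that the vector \<open>v\<close> of
    generators is an eigenvector with eigenvalue \<open>x\<close>.\<close>
  define A where "A = mat k k (\<lambda>(i,j). u (bs ! i) (bs ! j))"
  define C where "C = (map_mat of_int A :: complex mat)"
  define v where "v = vec k (\<lambda>i. bs ! i)"
  have A: "A \<in> carrier_mat k k" and C: "C \<in> carrier_mat k k" by (auto simp: A_def C_def)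
  have sumB: "(\<Sum>v\<in>B. g v) = (\<Sum>j<k. g (bs ! j))" for g :: "complex \<Rightarrow> complex"
    using bs by (intro sum.reindex_bij_betw[symmetric] bij_betw_nth) (auto simp: k_def)
  have "C *\<^sub>v v = x \<cdot>\<^sub>v v"
  proof (rule eq_vecI)
    fix i assume "i < dim_vec (x \<cdot>\<^sub>v v)"
    then have i: "i < k" by (simp add: v_def)
    have "(C *\<^sub>v v) $ i = (\<Sum>j<k. of_int (u (bs!i) (bs!j)) * bs ! j)"
      using i by (simp add: C_def A_def v_def scalar_prod_def lessThan_atLeast0)
    also have "\<dots> = x * bs ! i"
      using u[of "bs ! i"] i bs sumB by (auto simp: k_def)
    finally show "(C *\<^sub>v v) $ i = (x \<cdot>\<^sub>v v) $ i" using i by (simp add: v_def)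
  qed (simp add: C_def A_def v_def)
  \<comment> \<open>An eigenvector has to be non-zero: otherwise all generators vanish, which
    \<open>1 \<in> W\<close> rules out.\<close>
  moreover have "v \<noteq> 0\<^sub>v k"
  proof
    assume v0: "v = 0\<^sub>v k"
    have "bs ! i = 0" if "i < k" for i
      using that v0 by (metis index_zero_vec(1) index_vec v_def)
    then have "B \<subseteq> {0}" using bs by (auto simp: k_def in_set_conv_nth)
    then have "int_span.span B \<subseteq> int_span.span {0}" by (rule int_span.span_mono)
    also have "\<dots> = {0}" by (simp add: int_span.span_finite image_constant_conv)
    finally show False using fg_subring_ring(2)[OF W] B by auto
  qed
  ultimately have "eigenvalue C x"
    unfolding eigenvalue_def eigenvector_def using C by (intro exI[of _ v]) (auto simp: v_def)
  then have "poly (char_poly C) x = 0" using eigenvalue_root_char_poly[OF C] by simp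
  moreover have "char_poly C = map_poly of_int (char_poly A)"
    unfolding C_def by (rule of_int_hom.char_poly_hom[OF A])
  moreover have "lead_coeff (char_poly A) = 1" using degree_monic_char_poly[OF A] by simp
  ultimately show ?thesis unfolding algebraic_int_altdef_ipoly by metis
qed

lemma fg_subring_Ints: "fg_subring (range of_int)"
proof -
  have "int_span.span {1} = range of_int"
    by (auto simp: int_span.span_finite)
  moreover have "1 \<in> range (of_int :: int \<Rightarrow> complex)" by (rule range_eqI[of _ _ 1]) simp
  moreover have "x * y \<in> range of_int" if "x \<in> range of_int" "y \<in> range of_int" for x y :: complex
    using that by (auto simp flip: of_int_mult)
  moreover have "finite {1::complex}" by simp
  ultimately show ?thesis unfolding fg_subring_def by blast
qed

lemma coeff_mult_in_fg_subring:
  assumes W: "fg_subring W" and "\<And>i. coeff p i \<in> W" "\<And>i. coeff q i \<in> W"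
  shows "coeff (p * q) i \<in> W"
  unfolding coeff_mult using assms by (intro fg_subring_sum fg_subring_ring)

text \<open>As \<open>p\<close> is monic, it rewrites \<open>x ^ i\<close> with
  \<open>i \<ge> d\<close> in lower powers of \<open>x\<close> without division. Hence the finitely
  many products \<open>b * x ^ j\<close> with \<open>b \<in> B\<close> and \<open>j < d\<close>
  generate \<open>V\<close>, the ring of values at \<open>x\<close> of polynomials over
  \<open>W\<close>.\<close>

lemma fg_subring_adjoin:
  assumes W: "fg_subring W" and p: "lead_coeff p = 1" "\<And>i. coeff p i \<in> W" "poly p x = 0"
  shows "\<exists>W'. fg_subring W' \<and> W \<subseteq> W' \<and> x \<in> W'"
proof -
  define V where "V = {poly q x | q. \<forall>i. coeff q i \<in> W}"
  define d where "d = degree p"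
  obtain B where B: "finite B" "W = int_span.span B" using W by (auto simp: fg_subring_def)
  define B' where "B' = (\<lambda>(b,j). b * x ^ j) ` (B \<times> {..<d})"
  note R = fg_subring_ring[OF W]
  have VI: "poly q x \<in> V" if "\<And>i. coeff q i \<in> W" for q using that by (auto simp: V_def)
  have Vsub: "int_span.subspace V"
    unfolding int_span.subspace_def
  proof (intro conjI allI ballI)
    show "0 \<in> V" using VI[of 0] R by auto
    fix u v c assume u: "u \<in> V"
    then obtain q where q: "u = poly q x" "\<And>i. coeff q i \<in> W" by (auto simp: V_def)
    show "of_int c * u \<in> V" using VI[of "smult (of_int c) q"] q R by auto
    assume "v \<in> V"
    then obtain r where r: "v = poly r x" "\<And>i. coeff r i \<in> W" by (auto simp: V_def)
    show "u + v \<in> V" using VI[of "q + r"] q r R by auto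
  qed
  have xd: "x ^ d = - (\<Sum>j<d. coeff p j * x ^ j)"
  proof -
    have "0 = (\<Sum>j\<le>d. coeff p j * x ^ j)" using p(3) by (simp add: poly_altdef d_def)
    also have "\<dots> = (\<Sum>j<d. coeff p j * x ^ j) + x ^ d"
      using p(1) by (simp add: d_def lessThan_Suc_atMost[symmetric])
    finally show ?thesis by (simp add: add_eq_0_iff)
  qed
  have pw: "w * x ^ i \<in> int_span.span B'" if "w \<in> W" for w i
    using that
  proof (induction i arbitrary: w rule: less_induct)
    case (less i)
    show ?case
    proof (cases "i < d")
      case True
      have "w \<in> {w. w * x ^ i \<in> int_span.span B'}"
      proof (rule int_span.span_induct_alt[of w B "\<lambda>w. w \<in> {w. w * x ^ i \<in> int_span.span B'}"])
        show "w \<in> int_span.span B" using less.prems B by auto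
        show "0 \<in> {w. w * x ^ i \<in> int_span.span B'}" by (simp add: int_span.span_zero)
        fix c b y assume b: "b \<in> B" and y: "y \<in> {w. w * x ^ i \<in> int_span.span B'}"
        have "b * x ^ i \<in> B'" using b True unfolding B'_def by (intro image_eqI[of _ _ "(b,i)"]) auto
        then have "of_int c * (b * x ^ i) + y * x ^ i \<in> int_span.span B'"
          using y by (intro int_span.span_add int_span.span_scale) (auto intro: int_span.span_base)
        then show "of_int c * b + y \<in> {w. w * x ^ i \<in> int_span.span B'}" by (simp add: algebra_simps)
      qed
      then show ?thesis by simp
    next
      case False
      have "w * x ^ i = w * x ^ (i - d) * x ^ d" using False by (simp flip: power_add)
      also have "\<dots> = (\<Sum>j<d. (- (coeff p j * w)) * x ^ (i - d + j))"
        unfolding xd by (simp add: sum_distrib_left power_add algebra_simps sum_negf)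
      also have "\<dots> \<in> int_span.span B'"
        by (intro int_span.span_sum less.IH R) (use False p less.prems in auto)
      finally show ?thesis .
    qed
  qed
  have "V \<subseteq> int_span.span B'"
    unfolding V_def by (auto simp: poly_altdef intro!: int_span.span_sum pw)
  moreover have "B' \<subseteq> V"
  proof
    fix y assume "y \<in> B'"
    then obtain b j where y: "b \<in> B" "y = b * x ^ j" by (auto simp: B'_def)
    have "b \<in> W" using y B int_span.span_base by blast
    then show "y \<in> V" using VI[of "monom b j"] y R by (auto simp: poly_monom)
  qed
  then have "int_span.span B' \<subseteq> V" using Vsub int_span.span_minimal by blast
  ultimately have "V = int_span.span B'" by blast
  moreover have "finite B'" using B by (auto simp: B'_def)
  moreover have "w \<in> V" if "w \<in> W" for w using VI[of "[:w:]"] that R by (auto simp: coeff_pCons split: nat.splits)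
  moreover have "x \<in> V" using VI[of "[:0,1:]"] R by (auto simp: coeff_pCons split: nat.splits)
  moreover have "u * v \<in> V" if "u \<in> V" "v \<in> V" for u v
  proof -
    from that obtain q r where "u = poly q x" "v = poly r x" "\<And>i. coeff q i \<in> W" "\<And>i. coeff r i \<in> W"
      by (auto simp: V_def)
    then show ?thesis using VI[of "q * r"] coeff_mult_in_fg_subring[OF W] by simp
  qed
  ultimately show ?thesis using R unfolding fg_subring_def by (intro exI[of _ V]) auto
qed

lemma finite_algebraic_int_subset_fg_subring:
  assumes "finite X" "\<And>x. x \<in> X \<Longrightarrow> algebraic_int x"
  shows "\<exists>W. fg_subring W \<and> X \<subseteq> W"
  using assms
proof (induction X)
  case empty
  then show ?case using fg_subring_Ints by auto
next
  case (insert x X)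
  then obtain W where W: "fg_subring W" "X \<subseteq> W" by auto
  from insert.prems[of x] obtain p where p: "lead_coeff p = 1" "\<And>i. coeff p i \<in> \<int>" "poly p x = 0"
    by (auto simp: algebraic_int.simps)
  have "coeff p i \<in> W" for i using p(2)[of i] fg_subring_ring(6)[OF W(1)] by (auto elim: Ints_cases)
  from fg_subring_adjoin[OF W(1) p(1) this p(3)] W(2) show ?case by blast
qed

lemma algebraic_int_plus_times:
  assumes "algebraic_int (x::complex)" "algebraic_int y"
  shows "algebraic_int (x + y)" "algebraic_int (x * y)"
proof -
  obtain W where W: "fg_subring W" "{x, y} \<subseteq> W"
    using finite_algebraic_int_subset_fg_subring[of "{x, y}"] assms by auto
  show "algebraic_int (x + y)" "algebraic_int (x * y)"
    by (rule fg_subring_imp_algebraic_int[OF W(1)], use W fg_subring_ring[OF W(1)] in auto)+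
qed

lemma algebraic_int_sum_prod:
  assumes "\<And>i. i \<in> A \<Longrightarrow> algebraic_int (f i :: complex)"
  shows "algebraic_int (sum f A)" "algebraic_int (prod f A)"
  using assms by (induction A rule: infinite_finite_induct) (auto intro: algebraic_int_plus_times)

lemma algebraic_int_power: "algebraic_int (x::complex) \<Longrightarrow> algebraic_int (x ^ k)"
  by (induction k) (auto intro: algebraic_int_plus_times)

section \<open>Integrality of the leading coefficient times a product of roots\<close>

lemma integral_over_algebraic_int:
  assumes "lead_coeff p = 1" "\<And>i. algebraic_int (coeff p i)" "poly p (x::complex) = 0"
  shows "algebraic_int x"
proof -
  obtain W where W: "fg_subring W" "coeff p ` {..degree p} \<subseteq> W"
    using finite_algebraic_int_subset_fg_subring[of "coeff p ` {..degree p}"] assms(2) by auto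
  have "coeff p i \<in> W" for i
    using W fg_subring_ring(1)[OF W(1)] by (cases "i \<le> degree p") (auto simp: coeff_eq_0)
  from fg_subring_adjoin[OF W(1) assms(1) this assms(3)] show ?thesis
    using fg_subring_imp_algebraic_int by blast
qed

text \<open>Multiplying the equation of \<open>x\<close> by \<open>a ^ (d - 1)\<close> turns it into
  a monic equation \<open>q\<close> for \<open>a * x\<close> whose coefficients are still
  integral.\<close>

lemma algebraic_int_lead_coeff_mult:
  assumes "\<And>i. algebraic_int (coeff p i)" "poly p (x::complex) = 0" "p \<noteq> 0"
  shows "algebraic_int (lead_coeff p * x)"
proof -
  define a d where "a = lead_coeff p" and "d = degree p"
  have d: "d > 0" using assms(2,3) by (metis d_def degree_eq_zeroE gr0I poly_const_conv pCons_0_0)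
  have a0: "a \<noteq> 0" using assms(3) by (simp add: a_def)
  define q where "q = monom 1 d + (\<Sum>i<d. monom (coeff p i * a ^ (d - 1 - i)) i)"
  have cq: "coeff q i = (if i = d then 1 else if i < d then coeff p i * a ^ (d - 1 - i) else 0)" for i
    by (simp add: q_def coeff_sum coeff_monom sum.delta)
  have "degree q = d"
  proof (rule antisym)
    show "degree q \<le> d" by (rule degree_le) (simp add: cq)
    show "d \<le> degree q" by (rule le_degree) (simp add: cq)
  qed
  then have 1: "lead_coeff q = 1" by (simp add: cq)
  have 2: "algebraic_int (coeff q i)" for i
    using assms(1) by (simp add: cq a_def algebraic_int_plus_times algebraic_int_power)
  have "poly q (a * x) = (a * x) ^ d + (\<Sum>i<d. coeff p i * a ^ (d - 1 - i) * (a * x) ^ i)"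
    by (simp add: q_def poly_sum poly_monom)
  also have "(\<Sum>i<d. coeff p i * a ^ (d - 1 - i) * (a * x) ^ i) = (\<Sum>i<d. a ^ (d - 1) * (coeff p i * x ^ i))"
  proof (rule sum.cong)
    fix i assume "i \<in> {..<d}"
    then have "a ^ (d - 1) = a ^ (d - 1 - i) * a ^ i" by (simp flip: power_add)
    then show "coeff p i * a ^ (d - 1 - i) * (a * x) ^ i = a ^ (d - 1) * (coeff p i * x ^ i)"
      by (simp add: power_mult_distrib)
  qed simp
  also have "(a * x) ^ d = a ^ (d - 1) * (coeff p d * x ^ d)"
  proof -
    have "coeff p d = a" by (simp add: a_def d_def)
    then show ?thesis using d by (cases d) (simp_all add: power_mult_distrib)
  qed
  also have "\<dots> + (\<Sum>i<d. a ^ (d - 1) * (coeff p i * x ^ i)) = a ^ (d - 1) * (\<Sum>i\<le>d. coeff p i * x ^ i)"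
    by (simp add: lessThan_Suc_atMost[symmetric] sum_distrib_left algebra_simps)
  also have "(\<Sum>i\<le>d. coeff p i * x ^ i) = 0" using assms(2) by (simp add: poly_altdef d_def)
  finally have "poly q (a * x) = 0" by simp
  from integral_over_algebraic_int[OF 1 2 this] show ?thesis by (simp add: a_def)
qed

text \<open>Induction on the degree, removing the leading term of \<open>q\<close>. The product
  \<open>p\<close> then changes by \<open>- l X\<^sup>d\<^sup>+\<^sup>1 + l r X\<^sup>d\<close>,
  which is integral: \<open>l\<close> is the leading coefficient of \<open>p\<close> and
  \<open>r\<close> is a root of \<open>p\<close>, so \<open>l * r\<close> is an algebraic integer as
  well.\<close>

lemma algebraic_int_coeff_linear_quotient:
  assumes "\<And>i. algebraic_int (coeff ([:- r, 1:] * q) i :: complex)"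
  shows "algebraic_int (coeff q i)"
proof -
  have "\<forall>i. algebraic_int (coeff q i)" if "degree q < n" "\<And>i. algebraic_int (coeff ([:- r, 1:] * q) i)" for n q
    using that
  proof (induction n arbitrary: q)
    case (Suc n)
    show ?case
    proof (cases "q = 0")
      case False
      define p l d where "p = [:- r, 1:] * q" and "l = lead_coeff q" and "d = degree q"
      define q' where "q' = q - monom l d"
      have "[:- r, 1:] \<noteq> 0" by simp
      then have p0: "p \<noteq> 0" "poly p r = 0" using False unfolding p_def
        by (metis mult_eq_0_iff, simp)
      have lp: "lead_coeff p = l" unfolding p_def lead_coeff_mult by (simp add: l_def)
      have l: "algebraic_int l" using Suc.prems(2)[of "degree p"] lp by (simp add: p_def)
      have lr: "algebraic_int (l * r)"
        using algebraic_int_lead_coeff_mult[of p r] Suc.prems(2) p0 lp by (simp add: p_def)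
      have cq': "coeff q' i = (if i = d then 0 else coeff q i)" for i
        by (auto simp: q'_def coeff_monom l_def d_def)
      have eq: "[:- r, 1:] * q' = p - monom l (Suc d) + monom (l * r) d"
        by (simp add: q'_def p_def algebra_simps monom_Suc smult_monom add_monom)
      have mon: "algebraic_int (coeff (monom c k) i)" if "algebraic_int c" for c :: complex and k i
        using that by (simp add: coeff_monom)
      have prod: "algebraic_int (coeff ([:- r, 1:] * q') i)" for i
      proof -
        have "coeff ([:- r, 1:] * q') i = coeff p i + (- coeff (monom l (Suc d)) i + coeff (monom (l * r) d) i)"
          unfolding eq by simp
        moreover have "algebraic_int (coeff p i)" using Suc.prems(2) by (simp add: p_def)
        ultimately show ?thesis using mon[OF l] mon[OF lr]
          by (metis algebraic_int_plus_times(1) algebraic_int_minus)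
      qed
      have "\<forall>i. algebraic_int (coeff q' i)"
      proof (cases "q' = 0")
        case False
        have "degree q' \<le> d" by (rule degree_le) (auto simp: cq' d_def coeff_eq_0)
        moreover have "degree q' \<noteq> d" using False cq'[of d] leading_coeff_0_iff[of q'] by auto
        ultimately have "degree q' < n" using Suc.prems(1) by (simp add: d_def)
        then show ?thesis using Suc.IH prod by blast
      qed simp
      then have "algebraic_int (coeff q i)" for i
        using cq'[of i] l by (cases "i = d") (auto simp: l_def d_def split: if_splits dest: spec[of _ i])
      then show ?thesis by blast
    qed simp
  qed simp
  from this[of q "Suc (degree q)"] assms show ?thesis by blast
qed

text \<open>Dividing out the linear factors of the roots outside \<open>S\<close> keeps the
  coefficients integral, and the constant coefficient of what is left is \<open>a * \<Prod>S\<close>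
  up to sign.\<close>

lemma algebraic_int_lead_coeff_prod_subset:
  assumes "finite X" "S \<subseteq> X" "\<And>i. algebraic_int (coeff (smult a (\<Prod>x\<in>X. [:- x, 1:])) i)"
  shows "algebraic_int (a * \<Prod>S :: complex)"
proof -
  have fS: "finite S" using assms finite_subset by auto
  have *: "\<forall>i. algebraic_int (coeff (smult a (\<Prod>x\<in>S. [:- x, 1:])) i)"
    if "finite T" "T \<inter> S = {}" "\<And>i. algebraic_int (coeff (smult a (\<Prod>x\<in>T \<union> S. [:- x, 1:])) i)" for T
    using that
  proof (induction T)
    case (insert t T)
    have "(\<Prod>x\<in>insert t T \<union> S. [:- x, 1:]) = [:- t, 1:] * (\<Prod>x\<in>T \<union> S. [:- x, 1:])"
      using insert.hyps insert.prems fS by (simp only: Un_insert_left) (subst prod.insert, auto)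
    then have "\<And>i. algebraic_int (coeff ([:- t, 1:] * smult a (\<Prod>x\<in>T \<union> S. [:- x, 1:])) i)"
      using insert.prems by (metis mult_smult_right)
    then show ?case using insert.IH insert.prems algebraic_int_coeff_linear_quotient by blast
  qed simp
  have "(X - S) \<union> S = X" using assms by auto
  with *[of "X - S"] assms have "algebraic_int (coeff (smult a (\<Prod>x\<in>S. [:- x, 1:])) 0)" by auto
  also have "coeff (smult a (\<Prod>x\<in>S. [:- x, 1:])) 0 = a * (\<Prod>x\<in>S. - x)"
    by (simp add: poly_prod flip: poly_0_coeff_0)
  also have "(\<Prod>x\<in>S. - x) = (- 1) ^ card S * \<Prod>S"
    using prod.distrib[of "\<lambda>_. - 1" "\<lambda>x. x" S] by simp
  finally have "algebraic_int (a * ((- 1) ^ card S * \<Prod>S))" .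
  then show ?thesis by (cases "even (card S)") auto
qed

section \<open>Algebraic numbers as quotients of algebraic integers by integers\<close>

lemma algebraic_iff_scaled_algebraic_int:
  "algebraic (x::complex) \<longleftrightarrow> (\<exists>d::int. d \<noteq> 0 \<and> algebraic_int (of_int d * x))"
proof
  assume "algebraic x"
  then obtain p where p: "\<And>i. coeff p i \<in> \<int>" "p \<noteq> 0" "poly p x = 0" by (auto simp: algebraic_def)
  obtain d where d: "lead_coeff p = of_int d" using p(1) by (auto elim: Ints_cases)
  have "algebraic_int (lead_coeff p * x)"
    using p by (intro algebraic_int_lead_coeff_mult int_imp_algebraic_int)
  then show "\<exists>d::int. d \<noteq> 0 \<and> algebraic_int (of_int d * x)"
    using d p by (intro exI[of _ d]) auto
next
  assume "\<exists>d::int. d \<noteq> 0 \<and> algebraic_int (of_int d * x)"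
  then obtain d :: int where d: "d \<noteq> 0" "algebraic_int (of_int d * x)" by auto
  then obtain p where p: "\<And>i. coeff p i \<in> \<int>" "p \<noteq> 0" "poly p (of_int d * x) = 0"
    by (metis algebraic_def algebraic_int_imp_algebraic)
  define q where "q = pcompose p [:0, of_int d:]"
  have "poly q x = 0" using p by (simp add: q_def poly_pcompose mult.commute)
  moreover have "q \<noteq> 0" using p d pcompose_eq_0[of p "[:0, of_int d:]"] by (auto simp: q_def)
  moreover have "coeff q i \<in> \<int>" for i
    using p by (simp add: q_def coeff_pcompose_linear)
  ultimately show "algebraic x" unfolding algebraic_def by blast
qed

lemma algebraic_plus_times:
  assumes "algebraic (x::complex)" "algebraic y"
  shows "algebraic (x + y)" "algebraic (x * y)"
proof -
  from assms obtain d e :: int where d: "d \<noteq> 0" "algebraic_int (of_int d * x)"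
    and e: "e \<noteq> 0" "algebraic_int (of_int e * y)"
    by (auto simp: algebraic_iff_scaled_algebraic_int)
  have "algebraic_int (of_int e * (of_int d * x) + of_int d * (of_int e * y))"
    by (rule algebraic_int_plus_times(1); rule algebraic_int_plus_times(2)) (use d e in auto)
  then have "algebraic_int (of_int (d * e) * (x + y))" by (simp add: algebra_simps)
  then show "algebraic (x + y)" using d e unfolding algebraic_iff_scaled_algebraic_int
    by (intro exI[of _ "d * e"]) auto
  have "algebraic_int ((of_int d * x) * (of_int e * y))"
    by (rule algebraic_int_plus_times(2)[OF d(2) e(2)])
  then have "algebraic_int (of_int (d * e) * (x * y))" by (simp add: algebra_simps)
  then show "algebraic (x * y)" using d e unfolding algebraic_iff_scaled_algebraic_int
    by (intro exI[of _ "d * e"]) auto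
qed


section \<open>Conjugation of algebraic numbers\<close>

interpretation rat_cpoly: map_poly_inj_idom_hom "of_rat :: rat \<Rightarrow> complex" ..

lemma algebraic_sum: "(\<And>i. i \<in> A \<Longrightarrow> algebraic (f i :: complex)) \<Longrightarrow> algebraic (sum f A)"
  by (induction A rule: infinite_finite_induct) (auto intro: algebraic_plus_times)

lemma algebraic_power: "algebraic (x::complex) \<Longrightarrow> algebraic (x ^ k)"
  by (induction k) (auto intro: algebraic_plus_times)

lemma algebraic_poly:
  "(\<And>i. algebraic (coeff p i :: complex)) \<Longrightarrow> algebraic x \<Longrightarrow> algebraic (poly p x)"
  unfolding poly_altdef by (intro algebraic_sum algebraic_plus_times algebraic_power)

lemma algebraic_iff_rat_poly:
  "algebraic (x::complex) \<longleftrightarrow> (\<exists>p::rat poly. p \<noteq> 0 \<and> poly (map_poly of_rat p) x = 0)"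
proof
  assume "algebraic x"
  then obtain p where p: "\<And>i. coeff p i \<in> \<int>" "p \<noteq> 0" "poly p x = 0" by (auto simp: algebraic_def)
  have "\<forall>i. \<exists>c. coeff p i = of_int c" using p(1) by (meson Ints_cases)
  then obtain c where c: "\<And>i. coeff p i = of_int (c i)" by metis
  define q where "q = (\<Sum>i\<le>degree p. monom (rat_of_int (c i)) i)"
  have "map_poly of_rat q = p"
  proof (rule poly_eqI)
    fix i
    have "coeff q i = (if i \<le> degree p then of_int (c i) else 0)" by (simp add: q_def coeff_sum)
    then show "coeff (map_poly of_rat q) i = coeff p i"
      using c[of i] by (cases "i \<le> degree p") (simp_all add: coeff_map_poly coeff_eq_0)
  qed
  then have "q \<noteq> 0 \<and> poly (map_poly of_rat q) x = 0" using p by auto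
  then show "\<exists>p::rat poly. p \<noteq> 0 \<and> poly (map_poly of_rat p) x = 0" by blast
next
  assume "\<exists>p::rat poly. p \<noteq> 0 \<and> poly (map_poly of_rat p) x = 0"
  then obtain p :: "rat poly" where p: "p \<noteq> 0" "poly (map_poly of_rat p) x = 0" by auto
  have "\<exists>p. (\<forall>i. coeff p i \<in> \<rat>) \<and> p \<noteq> 0 \<and> poly p x = 0"
    using p by (intro exI[of _ "map_poly of_rat p"]) (simp add: coeff_map_poly)
  then show "algebraic x" unfolding algebraic_altdef by blast
qed

lemma algebraic_imp_nonzero_const_coeff:
  assumes "algebraic (x::complex)" "x \<noteq> 0"
  shows "\<exists>p::rat poly. coeff p 0 \<noteq> 0 \<and> poly (map_poly of_rat p) x = 0"
proof -
  obtain p :: "rat poly" where "p \<noteq> 0" "poly (map_poly of_rat p) x = 0"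
    using assms algebraic_iff_rat_poly by auto
  then show ?thesis
  proof (induction p)
    case (pCons a p)
    show ?case
    proof (cases "a = 0")
      case True
      then show ?thesis using pCons assms(2) by (auto simp: map_poly_pCons)
    next
      case False
      then show ?thesis using pCons by (intro exI[of _ "pCons a p"]) auto
    qed
  qed simp
qed

text \<open>
  The graphs of ring homomorphisms from rings of algebraic numbers to the complex numbers. Such a ring
  is automatically a field, so that the homomorphism is injective.
\<close>

definition partial_hom :: "(complex \<times> complex) set \<Rightarrow> bool" where
  "partial_hom M \<longleftrightarrow> (\<forall>q\<in>\<rat>. (q, q) \<in> M) \<and>
     (\<forall>x y u v. (x, y) \<in> M \<longrightarrow> (u, v) \<in> M \<longrightarrow> (x + u, y + v) \<in> M \<and> (x * u, y * v) \<in> M) \<and>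
     (\<forall>x y. (x, y) \<in> M \<longrightarrow> algebraic x) \<and> (\<forall>y. (0, y) \<in> M \<longrightarrow> y = 0)"

definition coeffs_related :: "(complex \<times> complex) set \<Rightarrow> complex poly \<Rightarrow> complex poly \<Rightarrow> bool" where
  "coeffs_related M p q \<longleftrightarrow> (\<forall>i. (coeff p i, coeff q i) \<in> M)"

text \<open>The extension of the homomorphism by \<open>x \<mapsto> y\<close>, given as a relation
  so that it can be formed before it is known to be single-valued.\<close>

definition adjoin_pair :: "(complex \<times> complex) set \<Rightarrow> complex \<Rightarrow> complex \<Rightarrow> (complex \<times> complex) set" where
  "adjoin_pair M x y = {(poly p x, poly q y) | p q. coeffs_related M p q}"

context
  fixes M assumes M: "partial_hom M"
begin

lemma partial_hom_ring:
  "q \<in> \<rat> \<Longrightarrow> (q, q) \<in> M" "(x, y) \<in> M \<Longrightarrow> (u, v) \<in> M \<Longrightarrow> (x + u, y + v) \<in> M"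
  "(x, y) \<in> M \<Longrightarrow> (u, v) \<in> M \<Longrightarrow> (x * u, y * v) \<in> M"
  "(0, 0) \<in> M" "(1, 1) \<in> M" "(x, y) \<in> M \<Longrightarrow> (- x, - y) \<in> M"
proof -
  show *: "q \<in> \<rat> \<Longrightarrow> (q, q) \<in> M" "(x, y) \<in> M \<Longrightarrow> (u, v) \<in> M \<Longrightarrow> (x + u, y + v) \<in> M"
    and m: "\<And>x y u v. (x, y) \<in> M \<Longrightarrow> (u, v) \<in> M \<Longrightarrow> (x * u, y * v) \<in> M" for q x y u v
    using M unfolding partial_hom_def by blast+
  show "(0, 0) \<in> M" "(1, 1) \<in> M" by (auto intro: *)
  have "(-1, -1) \<in> M" by (intro *) auto
  then show "(x, y) \<in> M \<Longrightarrow> (- x, - y) \<in> M" using m[of x y "-1" "-1"] by simp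
qed

lemma partial_hom_sum: "(\<And>i. i \<in> A \<Longrightarrow> (f i, g i) \<in> M) \<Longrightarrow> (sum f A, sum g A) \<in> M"
  by (induction A rule: infinite_finite_induct) (simp_all add: partial_hom_ring)

lemma partial_hom_power: "(x, y) \<in> M \<Longrightarrow> (x ^ k, y ^ k) \<in> M"
  by (induction k) (simp_all add: partial_hom_ring)

lemma coeffs_related_ops:
  assumes "coeffs_related M p q" "coeffs_related M r s"
  shows "coeffs_related M (p + r) (q + s)" "coeffs_related M (p * r) (q * s)"
    "coeffs_related M (p - r) (q - s)"
proof -
  show "coeffs_related M (p + r) (q + s)"
    using assms partial_hom_ring(2) by (simp add: coeffs_related_def)
  show "coeffs_related M (p * r) (q * s)"
    using assms by (simp add: coeffs_related_def coeff_mult partial_hom_sum partial_hom_ring(3))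
  have "(x - u, y - v) \<in> M" if "(x, y) \<in> M" "(u, v) \<in> M" for x y u v
    using partial_hom_ring(2)[OF that(1) partial_hom_ring(6)[OF that(2)]] by simp
  then show "coeffs_related M (p - r) (q - s)" using assms by (simp add: coeffs_related_def)
qed

lemma coeffs_related_const: "(a, b) \<in> M \<Longrightarrow> coeffs_related M [:a:] [:b:]"
  by (auto simp: coeffs_related_def coeff_pCons partial_hom_ring split: nat.splits)

lemma coeffs_related_monom: "(a, b) \<in> M \<Longrightarrow> coeffs_related M (monom a k) (monom b k)"
  by (auto simp: coeffs_related_def partial_hom_ring)

lemma coeffs_related_rat: "coeffs_related M (map_poly of_rat r) (map_poly of_rat r)"
  by (auto simp: coeffs_related_def coeff_map_poly intro: partial_hom_ring)

lemma partial_hom_unique: "(x, y) \<in> M \<Longrightarrow> (x, z) \<in> M \<Longrightarrow> y = z"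
proof -
  assume "(x, y) \<in> M" "(x, z) \<in> M"
  then have "(x + - x, y + - z) \<in> M" by (intro partial_hom_ring)
  then have "(0, y - z) \<in> M" by simp
  then have "y - z = 0" using M unfolding partial_hom_def by blast
  then show "y = z" by simp
qed

lemma coeffs_related_poly:
  assumes "coeffs_related M p q" "(x, y) \<in> M"
  shows "(poly p x, poly q y) \<in> M"
proof -
  define n where "n = max (degree p) (degree q)"
  have "poly p x = (\<Sum>i\<le>n. coeff p i * x ^ i)" "poly q y = (\<Sum>i\<le>n. coeff q i * y ^ i)"
    unfolding poly_altdef n_def by (intro sum.mono_neutral_left; auto simp: coeff_eq_0)+
  then show ?thesis using assms
    by (auto simp: coeffs_related_def intro!: partial_hom_sum partial_hom_ring partial_hom_power)
qed

text \<open>An annihilating polynomial of \<open>x \<noteq> 0\<close> can be chosen with non-zero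
  constant coefficient. It takes the value 0 at \<open>x\<close> and that coefficient at 0, so no
  homomorphism sends \<open>x\<close> to 0.\<close>

lemma partial_hom_inj: "(x, 0) \<in> M \<Longrightarrow> x = 0"
proof (rule ccontr)
  assume x: "(x, 0) \<in> M" "x \<noteq> 0"
  then have "algebraic x" using M by (auto simp: partial_hom_def)
  from algebraic_imp_nonzero_const_coeff[OF this x(2)] obtain p :: "rat poly"
    where p: "coeff p 0 \<noteq> 0" "poly (map_poly of_rat p) x = 0" by blast
  have "(poly (map_poly of_rat p) x, poly (map_poly of_rat p) 0) \<in> M"
    by (rule coeffs_related_poly[OF coeffs_related_rat x(1)])
  then have "(0, of_rat (coeff p 0)) \<in> M" using p by (simp add: poly_0_coeff_0)
  then show False using p M by (auto simp: partial_hom_def)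
qed

lemma coeffs_related_degree: "coeffs_related M p q \<Longrightarrow> degree p = degree q"
proof -
  assume r: "coeffs_related M p q"
  have "coeff p i = 0 \<longleftrightarrow> coeff q i = 0" for i
    using r partial_hom_inj M unfolding coeffs_related_def partial_hom_def by metis
  then show ?thesis unfolding degree_def by simp
qed

text \<open>
  Pseudo-division by the minimal polynomial \<open>p\<close> of \<open>x\<close> and, in parallel, by its image \<open>q\<close>.
\<close>

lemma adjoin_pair_single_valued:
  assumes pq: "coeffs_related M p q" "p \<noteq> 0" "poly p x = 0" "poly q y = 0"
    and min: "\<And>r s. coeffs_related M r s \<Longrightarrow> r \<noteq> 0 \<Longrightarrow> poly r x = 0 \<Longrightarrow> degree p \<le> degree r"
    and rs: "coeffs_related M r s" "poly r x = 0"
  shows "poly s y = 0"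
  using rs
proof (induction "degree r" arbitrary: r s rule: less_induct)
  case less
  show ?case
  proof (cases "r = 0")
    case True
    then have "(0, coeff s i) \<in> M" for i using less.prems by (auto simp: coeffs_related_def)
    then have "s = 0" using M by (intro poly_eqI) (auto simp: partial_hom_def)
    then show ?thesis by simp
  next
    case False
    define d e where "d = degree p" and "e = degree r"
    have de: "d \<le> e" using min less.prems False by (auto simp: d_def e_def)
    define a a' c c' where "a = coeff p d" and "a' = coeff q d" and "c = coeff r e" and "c' = coeff s e"
    have aM: "(a, a') \<in> M" and cM: "(c, c') \<in> M"
      using pq(1) less.prems(1) by (auto simp: a_def a'_def c_def c'_def coeffs_related_def)
    have a: "a \<noteq> 0" using pq(2) by (simp add: a_def d_def)
    then have a': "a' \<noteq> 0" using partial_hom_inj aM by blast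
    define r1 s1 where "r1 = [:a:] * r - monom c (e - d) * p" and "s1 = [:a':] * s - monom c' (e - d) * q"
    have rel: "coeffs_related M r1 s1" unfolding r1_def s1_def
      by (intro coeffs_related_ops coeffs_related_const coeffs_related_monom aM cM less.prems pq)
    have r1: "poly r1 x = 0" using pq less.prems by (simp add: r1_def)
    have s1: "poly s1 y = a' * poly s y" using pq by (simp add: s1_def)
    have "poly s1 y = 0"
    proof (cases "r1 = 0")
      case True
      then have "(0, coeff s1 i) \<in> M" for i using rel by (auto simp: coeffs_related_def)
      then have "s1 = 0" using M by (intro poly_eqI) (auto simp: partial_hom_def)
      then show ?thesis by simp
    next
      case r10: False
      have "degree r1 \<le> e"
        unfolding r1_def using de
        by (intro degree_diff_le order.trans[OF degree_mult_le])
          (auto simp: e_def d_def intro: order.trans[OF add_right_mono[OF degree_monom_le]])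
      moreover have "coeff r1 e = 0"
      proof -
        have "coeff (monom c (e - d) * p) e = c * a"
          using de by (simp add: coeff_monom_mult a_def)
        then show ?thesis by (simp add: r1_def c_def)
      qed
      then have "degree r1 \<noteq> e" using r10 leading_coeff_0_iff by metis
      ultimately have "degree r1 < degree r" by (simp add: e_def)
      then show ?thesis using less.hyps rel r1 by blast
    qed
    then show ?thesis using s1 a' by simp
  qed
qed

lemma partial_hom_adjoin_pair:
  assumes pq: "coeffs_related M p q" "p \<noteq> 0" "poly p x = 0" "poly q y = 0"
    and min: "\<And>r s. coeffs_related M r s \<Longrightarrow> r \<noteq> 0 \<Longrightarrow> poly r x = 0 \<Longrightarrow> degree p \<le> degree r"
    and x: "algebraic x"
  shows "partial_hom (adjoin_pair M x y)" "M \<subseteq> adjoin_pair M x y" "(x, y) \<in> adjoin_pair M x y"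
proof -
  have I: "coeffs_related M r s \<Longrightarrow> (poly r x, poly s y) \<in> adjoin_pair M x y" for r s
    by (auto simp: adjoin_pair_def)
  show sub: "M \<subseteq> adjoin_pair M x y"
  proof
    fix z assume "z \<in> M"
    then show "z \<in> adjoin_pair M x y"
      using I[OF coeffs_related_const[of "fst z" "snd z"]] by simp
  qed
  show "(x, y) \<in> adjoin_pair M x y"
    using I[OF coeffs_related_monom[OF partial_hom_ring(5), of 1]] by (simp add: poly_monom)
  show "partial_hom (adjoin_pair M x y)"
    unfolding partial_hom_def
  proof (intro conjI allI impI ballI)
    show "(q, q) \<in> adjoin_pair M x y" if "q \<in> \<rat>" for q using sub partial_hom_ring(1)[OF that] by blast
    fix u v assume uv: "(u, v) \<in> adjoin_pair M x y"
    then obtain r s where rs: "coeffs_related M r s" "u = poly r x" "v = poly s y"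
      by (auto simp: adjoin_pair_def)
    show "algebraic u" unfolding rs
    proof (rule algebraic_poly[OF _ x])
      fix i show "algebraic (coeff r i)" using rs M unfolding partial_hom_def coeffs_related_def by blast
    qed
    fix u' v' assume uv': "(u', v') \<in> adjoin_pair M x y"
    then obtain r' s' where rs': "coeffs_related M r' s'" "u' = poly r' x" "v' = poly s' y"
      by (auto simp: adjoin_pair_def)
    show "(u + u', v + v') \<in> adjoin_pair M x y" "(u * u', v * v') \<in> adjoin_pair M x y"
      using I[OF coeffs_related_ops(1)[OF rs(1) rs'(1)]] I[OF coeffs_related_ops(2)[OF rs(1) rs'(1)]]
      by (simp_all add: rs rs')
  next
    fix v assume "(0, v) \<in> adjoin_pair M x y"
    then obtain r s where rs: "coeffs_related M r s" "0 = poly r x" "v = poly s y"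
      by (auto simp: adjoin_pair_def)
    show "v = 0" unfolding rs(3)
      by (rule adjoin_pair_single_valued[OF pq]) (use min rs in auto)
  qed
qed

end

text \<open>
  Only the values of \<open>\<sigma>\<close> at algebraic numbers matter; the others are arbitrary.
\<close>

definition alg_hom :: "(complex \<Rightarrow> complex) \<Rightarrow> bool" where
  "alg_hom \<sigma> \<longleftrightarrow> (\<forall>q\<in>\<rat>. \<sigma> q = q) \<and>
     (\<forall>x y. algebraic x \<longrightarrow> algebraic y \<longrightarrow> \<sigma> (x + y) = \<sigma> x + \<sigma> y \<and> \<sigma> (x * y) = \<sigma> x * \<sigma> y)"

lemma partial_hom_chain_Union:
  assumes "\<C> \<noteq> {}" "subset.chain {M. partial_hom M \<and> M0 \<subseteq> M} \<C>"
  shows "partial_hom (\<Union>\<C>) \<and> M0 \<subseteq> \<Union>\<C>"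
proof -
  from assms(2) have C: "partial_hom X" "M0 \<subseteq> X" if "X \<in> \<C>" for X
    using that by (auto simp: subset.chain_def)
  have lin: "X \<subseteq> Y \<or> Y \<subseteq> X" if "X \<in> \<C>" "Y \<in> \<C>" for X Y
    using assms(2) that by (simp add: subset_chain_def)
  have "partial_hom (\<Union>\<C>)"
    unfolding partial_hom_def
  proof (intro conjI allI impI ballI)
    show "(q, q) \<in> \<Union>\<C>" if "q \<in> \<rat>" for q using assms(1) C(1) partial_hom_ring(1) that by blast
    fix u v assume "(u, v) \<in> \<Union>\<C>"
    then obtain X where X: "X \<in> \<C>" "(u, v) \<in> X" by blast
    then show "algebraic u" using C(1) unfolding partial_hom_def by blast
    fix u' v' assume "(u', v') \<in> \<Union>\<C>"
    then obtain Y where Y: "Y \<in> \<C>" "(u', v') \<in> Y" by blast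
    obtain Z where Z: "Z \<in> \<C>" "X \<subseteq> Z" "Y \<subseteq> Z" using lin[OF X(1) Y(1)] X Y by blast
    have "(u, v) \<in> Z" "(u', v') \<in> Z" using X Y Z by auto
    from partial_hom_ring(2,3)[OF C(1)[OF Z(1)] this] Z(1)
    show "(u + u', v + v') \<in> \<Union>\<C>" "(u * u', v * v') \<in> \<Union>\<C>" by blast+
  next
    fix v assume "(0, v) \<in> \<Union>\<C>"
    then show "v = 0" using C(1) unfolding partial_hom_def by blast
  qed
  then show ?thesis using C(2) assms(1) by blast
qed

text \<open>Zorn's lemma yields a maximal extension, and it is defined at every algebraic
  \<open>x\<close>: an annihilator of \<open>x\<close> of least degree over its domain is carried to
  a polynomial of the same degree, and any complex root \<open>y\<close> of that polynomial is an
  admissible image of \<open>x\<close>.\<close>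

lemma partial_hom_extends_to_alg_hom:
  assumes M0: "partial_hom M0"
  shows "\<exists>\<sigma>. alg_hom \<sigma> \<and> (\<forall>(x, y)\<in>M0. \<sigma> x = y)"
proof -
  have "\<exists>M\<in>{M. partial_hom M \<and> M0 \<subseteq> M}. \<forall>X\<in>{M. partial_hom M \<and> M0 \<subseteq> M}. M \<subseteq> X \<longrightarrow> X = M"
  proof (rule subset_Zorn_nonempty)
    show "{M. partial_hom M \<and> M0 \<subseteq> M} \<noteq> {}" using M0 by blast
    show "\<And>\<C>. \<C> \<noteq> {} \<Longrightarrow> subset.chain {M. partial_hom M \<and> M0 \<subseteq> M} \<C> \<Longrightarrow> \<Union>\<C> \<in> {M. partial_hom M \<and> M0 \<subseteq> M}"
      using partial_hom_chain_Union by blast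
  qed
  then obtain M where M': "M \<in> {M. partial_hom M \<and> M0 \<subseteq> M}"
    and max': "\<forall>X\<in>{M. partial_hom M \<and> M0 \<subseteq> M}. M \<subseteq> X \<longrightarrow> X = M" by (rule bexE)
  from M' have M: "partial_hom M" "M0 \<subseteq> M" by simp_all
  have max: "X = M" if "partial_hom X" "M0 \<subseteq> X" "M \<subseteq> X" for X
    using max' that by simp
  have total: "\<exists>y. (x, y) \<in> M" if x: "algebraic x" for x
  proof -
    obtain p0 :: "rat poly" where p0: "p0 \<noteq> 0" "poly (map_poly of_rat p0) x = 0"
      using x unfolding algebraic_iff_rat_poly by blast
    define P where "P r \<longleftrightarrow> (\<exists>s. coeffs_related M r s) \<and> r \<noteq> 0 \<and> poly r x = 0" for r
    have P0: "P (map_poly of_rat p0)"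
      using p0 coeffs_related_rat[OF M(1), of p0] by (auto simp: P_def)
    obtain p where p: "P p" "\<And>r. P r \<Longrightarrow> degree p \<le> degree r"
      using ex_has_least_nat[of P, OF P0, of degree] by auto
    then obtain q where q: "coeffs_related M p q" "p \<noteq> 0" "poly p x = 0" by (auto simp: P_def)
    have "degree p \<noteq> 0"
    proof
      assume "degree p = 0"
      then obtain c where "p = [:c:]" by (rule degree_eq_zeroE)
      then show False using q by simp
    qed
    then have "\<not> constant (poly q)"
      using coeffs_related_degree[OF M(1) q(1)] by (simp add: constant_degree)
    then obtain y where y: "poly q y = 0" using fundamental_theorem_of_algebra by blast
    have min: "degree p \<le> degree r" if "coeffs_related M r s" "r \<noteq> 0" "poly r x = 0" for r s
      using p(2) that by (auto simp: P_def)
    have ext: "partial_hom (adjoin_pair M x y)" "M \<subseteq> adjoin_pair M x y" "(x, y) \<in> adjoin_pair M x y"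
      by (rule partial_hom_adjoin_pair[OF M(1) q y _ x]; erule (2) min)+
    have "adjoin_pair M x y = M"
      by (rule max[OF ext(1) subset_trans[OF M(2) ext(2)] ext(2)])
    then have "(x, y) \<in> M" using ext(3) by simp
    then show ?thesis by (rule exI)
  qed
  define \<sigma> where "\<sigma> x = (SOME y. (x, y) \<in> M)" for x
  have \<sigma>: "(x, \<sigma> x) \<in> M" if "algebraic x" for x
    unfolding \<sigma>_def by (rule someI_ex[OF total[OF that]])
  have \<sigma>_eq: "\<sigma> x = y" if "(x, y) \<in> M" for x y
  proof (rule partial_hom_unique[OF M(1) \<sigma> that])
    show "algebraic x" using M(1) that unfolding partial_hom_def by blast
  qed
  have "alg_hom \<sigma>" unfolding alg_hom_def
  proof (intro conjI ballI allI impI)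
    show "\<sigma> q = q" if "q \<in> \<rat>" for q by (rule \<sigma>_eq[OF partial_hom_ring(1)[OF M(1) that]])
    show "\<sigma> (u + v) = \<sigma> u + \<sigma> v" if "algebraic u" "algebraic v" for u v
      by (rule \<sigma>_eq[OF partial_hom_ring(2)[OF M(1) \<sigma>[OF that(1)] \<sigma>[OF that(2)]]])
    show "\<sigma> (u * v) = \<sigma> u * \<sigma> v" if "algebraic u" "algebraic v" for u v
      by (rule \<sigma>_eq[OF partial_hom_ring(3)[OF M(1) \<sigma>[OF that(1)] \<sigma>[OF that(2)]]])
  qed
  moreover have "\<sigma> u = v" if "(u, v) \<in> M0" for u v using that M(2) by (intro \<sigma>_eq) auto
  ultimately show ?thesis by (intro exI[of _ \<sigma>] conjI ballI) auto
qed

section \<open>Conjugate roots of irreducible polynomials\<close>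

lemma irreducible_dvd_of_common_root:
  fixes f r :: "rat poly" and x :: complex
  assumes "irreducible f" "poly (map_poly of_rat f) x = 0" "poly (map_poly of_rat r) x = 0"
  shows "f dvd r"
proof (rule ccontr)
  assume "\<not> f dvd r"
  then have "Rings.coprime f r"
    using assms(1) by (metis field_poly_irreducible_imp_prime prime_elem_imp_coprime)
  then have "gcd f r = 1" by simp
  then obtain a b where "a * f + b * r = 1" using bezout_coefficients_fst_snd[of f r] by auto
  then have "poly (map_poly of_rat (a * f + b * r)) x = 1" by simp
  then show False using assms by (simp add: rat_cpoly.hom_add rat_cpoly.hom_mult)
qed

text \<open>The identity of the rationals extends by \<open>x \<mapsto> y\<close> because
  \<open>f\<close> has least degree among the rational annihilators of \<open>x\<close>, all of
  which it divides. The result then extends to all algebraic numbers.\<close>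

lemma conjugate_alg_hom:
  fixes f :: "rat poly"
  assumes f: "irreducible f" "poly (map_poly of_rat f) x = 0" "poly (map_poly of_rat f) y = 0"
  shows "\<exists>\<sigma>. alg_hom \<sigma> \<and> \<sigma> x = y"
proof -
  have "f \<noteq> 0" using f(1) by auto
  define M :: "(complex \<times> complex) set" where "M = {(q, q) | q. q \<in> \<rat>}"
  have M: "partial_hom M"
    unfolding partial_hom_def M_def by (auto intro: rat_imp_algebraic)
  have x: "algebraic x" unfolding algebraic_iff_rat_poly using f \<open>f \<noteq> 0\<close> by (intro exI[of _ f] conjI)
  have min: "degree (map_poly of_rat f :: complex poly) \<le> degree r"
    if r: "coeffs_related M r s" "r \<noteq> 0" "poly r x = 0" for r s
  proof -
    have "coeff r i \<in> \<rat>" for i using r(1) by (auto simp: coeffs_related_def M_def)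
    then have "\<forall>i. \<exists>c. coeff r i = of_rat c" by (meson Rats_cases)
    then obtain c where c: "\<And>i. coeff r i = of_rat (c i)" by metis
    define r' where "r' = (\<Sum>i\<le>degree r. monom (c i) i)"
    have r': "map_poly of_rat r' = r"
    proof (rule poly_eqI)
      fix i
      have "coeff r' i = (if i \<le> degree r then c i else 0)" by (simp add: r'_def coeff_sum)
      then show "coeff (map_poly of_rat r') i = coeff r i"
        using c[of i] by (cases "i \<le> degree r") (simp_all add: coeff_map_poly coeff_eq_0)
    qed
    then have "f dvd r'" using irreducible_dvd_of_common_root[OF f(1,2), of r'] r(3) by simp
    moreover have "r' \<noteq> 0" using r' r(2) by auto
    ultimately have "degree f \<le> degree r'" by (rule dvd_imp_degree_le)
    then show ?thesis by (simp flip: r')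
  qed
  have 0: "map_poly of_rat f \<noteq> (0 :: complex poly)" using \<open>f \<noteq> 0\<close> by simp
  have "partial_hom (adjoin_pair M x y)" "(x, y) \<in> adjoin_pair M x y"
    by (rule partial_hom_adjoin_pair[OF M coeffs_related_rat[OF M] 0 f(2,3) _ x]; erule (2) min)+
  from partial_hom_extends_to_alg_hom[OF this(1)] this(2) show ?thesis by auto
qed

lemma alg_hom_rat: "alg_hom \<sigma> \<Longrightarrow> q \<in> \<rat> \<Longrightarrow> \<sigma> q = q"
  and alg_hom_add: "alg_hom \<sigma> \<Longrightarrow> algebraic x \<Longrightarrow> algebraic y \<Longrightarrow> \<sigma> (x + y) = \<sigma> x + \<sigma> y"
  and alg_hom_mult: "alg_hom \<sigma> \<Longrightarrow> algebraic x \<Longrightarrow> algebraic y \<Longrightarrow> \<sigma> (x * y) = \<sigma> x * \<sigma> y"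
  by (auto simp: alg_hom_def)

lemma alg_hom_sum:
  "alg_hom \<sigma> \<Longrightarrow> (\<And>i. i \<in> A \<Longrightarrow> algebraic (f i)) \<Longrightarrow> \<sigma> (sum f A) = (\<Sum>i\<in>A. \<sigma> (f i))"
  by (induction A rule: infinite_finite_induct) (simp_all add: alg_hom_rat alg_hom_add algebraic_sum)

lemma algebraic_prod: "(\<And>i. i \<in> A \<Longrightarrow> algebraic (f i :: complex)) \<Longrightarrow> algebraic (prod f A)"
  by (induction A rule: infinite_finite_induct) (auto intro: algebraic_plus_times)

lemma alg_hom_prod:
  "alg_hom \<sigma> \<Longrightarrow> (\<And>i. i \<in> A \<Longrightarrow> algebraic (f i)) \<Longrightarrow> \<sigma> (prod f A) = (\<Prod>i\<in>A. \<sigma> (f i))"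
  by (induction A rule: infinite_finite_induct) (simp_all add: alg_hom_rat alg_hom_mult algebraic_prod)

lemma alg_hom_power: "alg_hom \<sigma> \<Longrightarrow> algebraic x \<Longrightarrow> \<sigma> (x ^ k) = \<sigma> x ^ k"
  by (induction k) (simp_all add: alg_hom_rat alg_hom_mult algebraic_power)

lemma alg_hom_inj:
  assumes s: "alg_hom \<sigma>" and x: "algebraic x" "algebraic y" "\<sigma> x = \<sigma> y"
  shows "x = y"
proof (rule ccontr)
  assume "x \<noteq> y"
  have a: "algebraic (- y)" using x by auto
  then have d: "algebraic (x - y)" using algebraic_plus_times(1)[OF x(1) a] by simp
  have "\<sigma> (y + - y) = \<sigma> y + \<sigma> (- y)" by (rule alg_hom_add[OF s x(2) a])
  moreover have "\<sigma> (x + - y) = \<sigma> x + \<sigma> (- y)" by (rule alg_hom_add[OF s x(1) a])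
  ultimately have 0: "\<sigma> (x - y) = 0" using x(3) alg_hom_rat[OF s, of 0] by simp
  have "algebraic (inverse (x - y))" using d by auto
  then have "\<sigma> ((x - y) * inverse (x - y)) = \<sigma> (x - y) * \<sigma> (inverse (x - y))"
    by (rule alg_hom_mult[OF s d])
  then show False using 0 \<open>x \<noteq> y\<close> alg_hom_rat[OF s, of 1] by simp
qed

lemma alg_hom_poly:
  assumes "alg_hom \<sigma>" "\<And>i. algebraic (coeff p i)" "algebraic x"
  shows "\<sigma> (poly p x) = (\<Sum>i\<le>degree p. \<sigma> (coeff p i) * \<sigma> x ^ i)"
  using assms unfolding poly_altdef
  by (simp add: alg_hom_sum alg_hom_mult alg_hom_power algebraic_power algebraic_plus_times)

lemma alg_hom_root:
  assumes "alg_hom \<sigma>" "poly (map_poly of_rat f) x = 0" "algebraic x"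
  shows "poly (map_poly of_rat f) (\<sigma> x) = 0"
proof -
  have "\<sigma> (poly (map_poly of_rat f) x) = poly (map_poly of_rat f) (\<sigma> x)"
    by (subst alg_hom_poly[OF assms(1) _ assms(3)])
      (auto simp: coeff_map_poly poly_altdef alg_hom_rat[OF assms(1)] rat_imp_algebraic)
  then show ?thesis using assms alg_hom_rat[OF assms(1), of 0] by simp
qed

lemma algebraic_has_irreducible:
  assumes "algebraic (x::complex)"
  shows "\<exists>f::rat poly. irreducible f \<and> poly (map_poly of_rat f) x = 0"
proof -
  obtain p :: "rat poly" where p: "p \<noteq> 0" "poly (map_poly of_rat p) x = 0"
    using assms algebraic_iff_rat_poly by auto
  have u: "\<not> is_unit p"
  proof
    assume "is_unit p"
    then obtain c where "p = [:c:]" by (metis is_unit_poly_iff)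
    then show False using p by simp
  qed
  from p u show ?thesis
  proof (induction "degree p" arbitrary: p rule: less_induct)
    case less
    show ?case
    proof (cases "irreducible p")
      case False
      then obtain a b where ab: "p = a * b" "\<not> is_unit a" "\<not> is_unit b"
        using less.prems unfolding irreducible_def by blast
      have ab0: "a \<noteq> 0" "b \<noteq> 0" using ab less.prems by auto
      have "degree a \<noteq> 0" "degree b \<noteq> 0" using ab ab0 by (auto simp: is_unit_iff_degree)
      then have "degree a < degree p" "degree b < degree p" using ab ab0 by (auto simp: degree_mult_eq)
      moreover have "poly (map_poly of_rat a) x = 0 \<or> poly (map_poly of_rat b) x = 0"
        using less.prems ab by (simp add: rat_cpoly.hom_mult)
      ultimately show ?thesis using less.hyps ab ab0 by blast
    qed (use less.prems in blast)
  qed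
qed

text \<open>A double root would be shared with the derivative, which is non-zero in characteristic 0
  and of smaller degree than \<open>f\<close>, so \<open>f\<close> cannot divide it.\<close>

lemma irreducible_no_double_root:
  fixes f :: "rat poly" and x :: complex
  assumes f: "irreducible f" "map_poly of_rat f = [:- x, 1:] * h"
  shows "poly h x \<noteq> 0"
proof
  assume h: "poly h x = 0"
  have fx: "poly (map_poly of_rat f) x = 0" unfolding f(2) by simp
  have deg: "degree f \<noteq> 0"
    using f(1) by (metis irreducible_not_unit is_unit_iff_degree not_irreducible_zero)
  have "poly (pderiv (map_poly of_rat f)) x = 0"
    unfolding f(2) pderiv_mult using h by (simp add: pderiv_pCons)
  moreover have "pderiv (map_poly of_rat f) = (map_poly of_rat (pderiv f) :: complex poly)"
    by (rule poly_eqI) (simp add: coeff_pderiv coeff_map_poly of_rat_mult of_rat_add)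
  ultimately have "poly (map_poly of_rat (pderiv f)) x = 0" by simp
  then have "f dvd pderiv f" by (rule irreducible_dvd_of_common_root[OF f(1) fx])
  moreover have "pderiv f \<noteq> 0" using deg by (simp add: pderiv_eq_0_iff)
  ultimately have "degree f \<le> degree (pderiv f)" by (rule dvd_imp_degree_le)
  then show False using deg by (simp add: degree_pderiv)
qed

text \<open>A root \<open>y\<close> of the cofactor \<open>h\<close> would be the image of
  \<open>x\<close> under some conjugation, and \<open>y\<close> differs from \<open>x\<close>
  because roots are simple. So the irreducible polynomial of \<open>x\<close> is linear.\<close>

lemma fixed_by_alg_homs_imp_rat:
  assumes x: "algebraic x" and fixd: "\<And>\<sigma>. alg_hom \<sigma> \<Longrightarrow> \<sigma> x = x"
  shows "x \<in> \<rat>"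
proof -
  obtain f :: "rat poly" where f: "irreducible f" "poly (map_poly of_rat f) x = 0"
    using algebraic_has_irreducible[OF x] by blast
  obtain h where h: "map_poly of_rat f = [:- x, 1:] * h"
    using f(2) by (metis poly_eq_0_iff_dvd dvdE)
  have "degree h = 0"
  proof (rule ccontr)
    assume "degree h \<noteq> 0"
    then obtain y where y: "poly h y = 0"
      using fundamental_theorem_of_algebra constant_degree by metis
    then have "poly (map_poly of_rat f) y = 0" using h by simp
    then obtain \<sigma> where "alg_hom \<sigma>" "\<sigma> x = y" using conjugate_alg_hom[OF f] by blast
    then show False using fixd[of \<sigma>] y irreducible_no_double_root[OF f(1) h] by simp
  qed
  then obtain c where c: "h = [:c:]" by (metis degree_eq_zeroE)
  have "c \<noteq> 0" using h c f(1) by auto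
  have "coeff (map_poly of_rat f) 0 = - x * c" "coeff (map_poly of_rat f) 1 = c"
    unfolding h c by simp_all
  then have "of_rat (coeff f 0) = - x * c" "of_rat (coeff f 1) = c" by (simp_all add: coeff_map_poly)
  then have "x = - (of_rat (coeff f 0) / of_rat (coeff f 1))" using \<open>c \<noteq> 0\<close> by (simp add: field_simps)
  then show ?thesis by (metis Rats_divide Rats_minus_iff Rats_of_rat)
qed


section \<open>Products of linear factors\<close>

text \<open>Vieta's formulas. Indexing the factors allows \<open>z\<close> to send each class of
  roots to its product without showing that these products are distinct.\<close>

lemma coeff_prod_linear:
  fixes z :: "'i \<Rightarrow> complex"
  assumes "finite I"
  shows "coeff (\<Prod>i\<in>I. [:- z i, 1:]) k = (\<Sum>S | S \<subseteq> I \<and> card (I - S) = k. (-1) ^ card S * (\<Prod>i\<in>S. z i))"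
proof -
  have "(\<Prod>i\<in>I. [:- z i, 1:]) = (\<Prod>i\<in>I. [:0, 1:] - [:z i:])" by simp
  also have "\<dots> = (\<Sum>S\<in>Pow I. (-1) ^ card S * (\<Prod>i\<in>S. [:z i:]) * (\<Prod>i\<in>I - S. [:0, 1:]))"
    by (rule prod_diff_conv_sum[OF assms])
  also have "\<dots> = (\<Sum>S\<in>Pow I. smult ((-1) ^ card S * (\<Prod>i\<in>S. z i)) (monom 1 (card (I - S))))"
  proof (rule sum.cong)
    fix S assume "S \<in> Pow I"
    have "(\<Prod>i\<in>S. [:z i:]) = [:\<Prod>i\<in>S. z i:]"
      by (induction S rule: infinite_finite_induct) simp_all
    then have "(-1) ^ card S * (\<Prod>i\<in>S. [:z i:]) = [:(-1) ^ card S * (\<Prod>i\<in>S. z i):]"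
      by (cases "even (card S)") simp_all
    then show "(-1) ^ card S * (\<Prod>i\<in>S. [:z i:]) * (\<Prod>i\<in>I - S. [:0, 1:]) =
       smult ((-1) ^ card S * (\<Prod>i\<in>S. z i)) (monom 1 (card (I - S)))"
      by (simp add: monom_altdef)
  qed simp
  finally have "coeff (\<Prod>i\<in>I. [:- z i, 1:]) k =
      (\<Sum>S\<in>Pow I. if card (I - S) = k then (-1) ^ card S * (\<Prod>i\<in>S. z i) else 0)"
    by (auto simp: coeff_sum intro!: sum.cong)
  also have "\<dots> = (\<Sum>S | S \<in> Pow I \<and> card (I - S) = k. (-1) ^ card S * (\<Prod>i\<in>S. z i))"
    using assms by (subst sum.inter_filter[symmetric]) (auto intro!: sum.cong)
  finally show ?thesis by simp
qed

lemma norm_coeff_prod_linear_le: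
  fixes z :: "'i \<Rightarrow> complex"
  assumes "finite I" and B: "\<And>S. S \<subseteq> I \<Longrightarrow> norm (a * (\<Prod>i\<in>S. z i)) \<le> B"
  shows "norm (coeff (smult a (\<Prod>i\<in>I. [:- z i, 1:])) k) \<le> 2 ^ card I * B"
proof -
  define F where "F = {S. S \<subseteq> I \<and> card (I - S) = k}"
  have fF: "finite F" and cF: "card F \<le> 2 ^ card I"
    using assms(1) card_mono[of "Pow I" F] by (auto simp: F_def card_Pow)
  have B0: "B \<ge> 0" using B[of "{}"] norm_ge_zero order_trans by blast
  have "norm (coeff (smult a (\<Prod>i\<in>I. [:- z i, 1:])) k)
      = norm (\<Sum>S\<in>F. (-1) ^ card S * (a * (\<Prod>i\<in>S. z i)))"
    unfolding coeff_smult coeff_prod_linear[OF assms(1)] F_def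
    by (simp add: sum_distrib_left mult_ac)
  also have "\<dots> \<le> (\<Sum>S\<in>F. B)"
  proof (rule sum_norm_le)
    fix S assume "S \<in> F"
    then show "norm ((-1) ^ card S * (a * (\<Prod>i\<in>S. z i))) \<le> B"
      using B[of S] by (simp add: F_def norm_mult norm_power)
  qed
  also have "\<dots> \<le> 2 ^ card I * B"
  proof -
    have "real (card F) \<le> 2 ^ card I" using of_nat_mono[OF cF, where 'a = real] by simp
    then show ?thesis using B0 by (simp add: mult_right_mono)
  qed
  finally show ?thesis .
qed

lemma algebraic_int_coeff_prod_linear:
  fixes z :: "'i \<Rightarrow> complex"
  assumes "finite I" "\<And>S. S \<subseteq> I \<Longrightarrow> algebraic_int (a * (\<Prod>i\<in>S. z i))"
  shows "algebraic_int (coeff (smult a (\<Prod>i\<in>I. [:- z i, 1:])) k)"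
proof -
  have "coeff (smult a (\<Prod>i\<in>I. [:- z i, 1:])) k
      = (\<Sum>S | S \<subseteq> I \<and> card (I - S) = k. (-1) ^ card S * (a * (\<Prod>i\<in>S. z i)))"
    unfolding coeff_smult coeff_prod_linear[OF assms(1)] by (simp add: sum_distrib_left mult_ac)
  also have "algebraic_int \<dots>"
  proof (rule algebraic_int_sum_prod(1))
    fix S assume "S \<in> {S. S \<subseteq> I \<and> card (I - S) = k}"
    then have "algebraic_int (a * (\<Prod>i\<in>S. z i))" using assms(2) by simp
    then show "algebraic_int ((-1) ^ card S * (a * (\<Prod>i\<in>S. z i)))"
      by (cases "even (card S)") simp_all
  qed
  finally show ?thesis .
qed

lemma alg_hom_coeff_prod_linear:
  assumes "alg_hom \<sigma>" "finite I" "\<And>i. i \<in> I \<Longrightarrow> algebraic (z i)"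
  shows "algebraic (coeff (\<Prod>i\<in>I. [:- z i, 1:]) k)"
    "\<sigma> (coeff (\<Prod>i\<in>I. [:- z i, 1:]) k) = coeff (\<Prod>i\<in>I. [:- \<sigma> (z i), 1:]) k"
proof -
  have a: "algebraic ((-1) ^ card S * (\<Prod>i\<in>S. z i))" if "S \<subseteq> I" for S
    using that assms(3) by (intro algebraic_plus_times algebraic_prod algebraic_power) auto
  show "algebraic (coeff (\<Prod>i\<in>I. [:- z i, 1:]) k)"
    unfolding coeff_prod_linear[OF assms(2)] by (rule algebraic_sum) (use a in auto)
  have "\<sigma> (coeff (\<Prod>i\<in>I. [:- z i, 1:]) k)
      = (\<Sum>S | S \<subseteq> I \<and> card (I - S) = k. \<sigma> ((-1) ^ card S * (\<Prod>i\<in>S. z i)))"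
    unfolding coeff_prod_linear[OF assms(2)] by (rule alg_hom_sum[OF assms(1)]) (use a in auto)
  also have "\<dots> = (\<Sum>S | S \<subseteq> I \<and> card (I - S) = k. (-1) ^ card S * (\<Prod>i\<in>S. \<sigma> (z i)))"
  proof (rule sum.cong)
    fix S assume S: "S \<in> {S. S \<subseteq> I \<and> card (I - S) = k}"
    have r: "(-1) ^ card S \<in> (\<rat> :: complex set)" by (intro Rats_power) simp
    have "\<sigma> ((-1) ^ card S * (\<Prod>i\<in>S. z i)) = \<sigma> ((-1) ^ card S) * \<sigma> (\<Prod>i\<in>S. z i)"
      by (rule alg_hom_mult[OF assms(1) rat_imp_algebraic[OF r]], rule algebraic_prod) (use S assms(3) in auto)
    also have "\<dots> = (-1) ^ card S * (\<Prod>i\<in>S. \<sigma> (z i))"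
      using S assms(3) r by (simp add: alg_hom_rat[OF assms(1)] subset_iff alg_hom_prod[OF assms(1)])
    finally show "\<sigma> ((-1) ^ card S * (\<Prod>i\<in>S. z i)) = (-1) ^ card S * (\<Prod>i\<in>S. \<sigma> (z i))" .
  qed simp
  also have "\<dots> = coeff (\<Prod>i\<in>I. [:- \<sigma> (z i), 1:]) k"
    unfolding coeff_prod_linear[OF assms(2)] ..
  finally show "\<sigma> (coeff (\<Prod>i\<in>I. [:- z i, 1:]) k) = coeff (\<Prod>i\<in>I. [:- \<sigma> (z i), 1:]) k" .
qed

text \<open>A conjugation only permutes the factors, so it fixes every coefficient of the
  product.\<close>

lemma rat_coeff_prod_linear:
  assumes "finite I" "\<And>i. i \<in> I \<Longrightarrow> algebraic (z i)"
    and perm: "\<And>\<sigma>. alg_hom \<sigma> \<Longrightarrow> \<exists>\<pi>. bij_betw \<pi> I I \<and> (\<forall>i\<in>I. \<sigma> (z i) = z (\<pi> i))"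
  shows "coeff (\<Prod>i\<in>I. [:- z i, 1:]) k \<in> \<rat>"
proof (rule fixed_by_alg_homs_imp_rat)
  have "alg_hom id" by (simp add: alg_hom_def)
  then show "algebraic (coeff (\<Prod>i\<in>I. [:- z i, 1:]) k)"
    by (rule alg_hom_coeff_prod_linear(1)[OF _ assms(1,2)])
  fix \<sigma> assume s: "alg_hom \<sigma>"
  then obtain \<pi> where p: "bij_betw \<pi> I I" "\<And>i. i \<in> I \<Longrightarrow> \<sigma> (z i) = z (\<pi> i)" using perm by blast
  have "(\<Prod>i\<in>I. [:- \<sigma> (z i), 1:]) = (\<Prod>i\<in>I. [:- z (\<pi> i), 1:])" using p(2) by (intro prod.cong) auto
  also have "\<dots> = (\<Prod>i\<in>I. [:- z i, 1:])" by (rule prod.reindex_bij_betw[OF p(1)])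
  finally show "\<sigma> (coeff (\<Prod>i\<in>I. [:- z i, 1:]) k) = coeff (\<Prod>i\<in>I. [:- z i, 1:]) k"
    using alg_hom_coeff_prod_linear(2)[OF s assms(1,2)] by simp
qed

lemma int_poly_of_Ints_coeffs:
  assumes "\<And>i. coeff p i \<in> (\<int> :: complex set)"
  shows "\<exists>h. map_poly of_int h = p"
proof -
  have "\<forall>i. \<exists>c. coeff p i = of_int c" using assms by (meson Ints_cases)
  then obtain c where c: "\<And>i. coeff p i = of_int (c i)" by metis
  define h where "h = (\<Sum>i\<le>degree p. monom (c i) i)"
  have "map_poly of_int h = p"
  proof (rule poly_eqI)
    fix i
    have "coeff h i = (if i \<le> degree p then c i else 0)" by (simp add: h_def coeff_sum)
    then show "coeff (map_poly of_int h) i = coeff p i"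
      using c[of i] by (cases "i \<le> degree p") (simp_all add: coeff_map_poly coeff_eq_0)
  qed
  then show ?thesis by blast
qed

text \<open>Enlarging the product to \<open>max 1 (norm x)\<close> over all roots gives the Mahler
  measure, which Landau's inequality bounds by the Euclidean norm of the coefficients, hence by
  \<open>sqrt (n + 1) * H\<close>. The factor \<open>n + 1\<close> merely avoids the square
  root.\<close>

lemma Landau_inequality_roots:
  fixes X :: "complex set"
  assumes "finite X" "T \<subseteq> X" and p: "p = smult a (\<Prod>x\<in>X. [:- x, 1:])"
    and H: "\<And>i. norm (coeff p i) \<le> H" and n: "degree p = n"
  shows "norm (a * \<Prod>T) \<le> (real n + 1) * H"
proof -
  obtain xs where xs: "set xs = X" "distinct xs" using finite_distinct_list[OF assms(1)] by blast
  have "norm (a * \<Prod>T) \<le> norm a * (\<Prod>x\<in>X. max 1 (norm x))"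
  proof -
    have "(\<Prod>x\<in>T. norm x) \<le> (\<Prod>x\<in>T. max 1 (norm x))" by (intro prod_mono) auto
    also have "\<dots> \<le> (\<Prod>x\<in>X. max 1 (norm x))"
      by (rule prod_mono2[OF assms(1,2)]) auto
    finally show ?thesis unfolding norm_mult prod_norm[symmetric] by (rule mult_left_mono) simp
  qed
  also have "\<dots> = mahler_measure_poly (smult a (\<Prod>x\<leftarrow>xs. [:- x, 1:]))"
    unfolding mahler_measure_poly_explicit xs(1)[symmetric] prod.distinct_set_conv_list[OF xs(2)] ..
  also have "(\<Prod>x\<leftarrow>xs. [:- x, 1:]) = (\<Prod>x\<in>X. [:- x, 1:])"
    unfolding xs(1)[symmetric] prod.distinct_set_conv_list[OF xs(2)] ..
  also have "mahler_measure_poly (smult a (\<Prod>x\<in>X. [:- x, 1:])) \<le> sqrt (\<Sum>c\<leftarrow>coeffs p. (cmod c)\<^sup>2)"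
    unfolding p by (rule Landau_inequality)
  also have "\<dots> \<le> (real n + 1) * H"
  proof (rule real_le_lsqrt)
    have H0: "H \<ge> 0" using H[of 0] norm_ge_zero order_trans by blast
    show "0 \<le> (real n + 1) * H" using H0 by simp
    have "(\<Sum>c\<leftarrow>coeffs p. (cmod c)\<^sup>2) \<le> (\<Sum>c\<leftarrow>coeffs p. H\<^sup>2)"
    proof (rule sum_list_mono)
      fix c assume "c \<in> set (coeffs p)"
      then obtain i where "c = coeff p i" by (metis in_set_conv_nth nth_coeffs_coeff length_coeffs_degree
            less_Suc_eq_le coeffs_eq_Nil empty_iff empty_set)
      then show "(cmod c)\<^sup>2 \<le> H\<^sup>2" using H by (simp add: power_mono)
    qed
    also have "\<dots> = real (length (coeffs p)) * H\<^sup>2" by (simp add: sum_list_triv)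
    also have "length (coeffs p) \<le> n + 1" using n by (cases "p = 0") (auto simp: length_coeffs_degree)
    then have "real (length (coeffs p)) * H\<^sup>2 \<le> (real n + 1) * H\<^sup>2"
      by (intro mult_right_mono) auto
    also have "\<dots> \<le> (real n + 1)\<^sup>2 * H\<^sup>2"
      by (intro mult_right_mono) (auto simp: power2_eq_square)
    finally show "(\<Sum>c\<leftarrow>coeffs p. (cmod c)\<^sup>2) \<le> ((real n + 1) * H)\<^sup>2" by (simp add: power_mult_distrib)
  qed
  finally show ?thesis .
qed


section \<open>Classes of roots modulo roots of unity\<close>

definition root_of_unity :: "complex \<Rightarrow> bool" where
  "root_of_unity z \<longleftrightarrow> (\<exists>k>0. z ^ k = 1)"

lemma root_of_unity_simps:
  "root_of_unity 1" "root_of_unity z \<Longrightarrow> root_of_unity (inverse z)"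
  "root_of_unity z \<Longrightarrow> root_of_unity w \<Longrightarrow> root_of_unity (z * w)"
  "root_of_unity z \<Longrightarrow> norm z = 1" "root_of_unity z \<Longrightarrow> algebraic_int z"
proof -
  show "root_of_unity 1" by (auto simp: root_of_unity_def)
  show "root_of_unity z \<Longrightarrow> root_of_unity (inverse z)" by (auto simp: root_of_unity_def power_inverse)
  show "root_of_unity (z * w)" if zw: "root_of_unity z" "root_of_unity w"
  proof -
    obtain k l where kl: "k > 0" "l > 0" "z ^ k = 1" "w ^ l = 1" using zw by (auto simp: root_of_unity_def)
    have "(z * w) ^ (k * l) = (z ^ k) ^ l * (w ^ l) ^ k"
      by (simp add: power_mult_distrib mult.commute flip: power_mult)
    then show ?thesis using kl unfolding root_of_unity_def by (intro exI[of _ "k * l"]) simp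
  qed
  show "norm z = 1" if r: "root_of_unity z"
  proof -
    obtain k where k: "k > 0" "z ^ k = 1" using r by (auto simp: root_of_unity_def)
    then have "norm z ^ k = 1" by (metis norm_one norm_power)
    then show ?thesis using k(1) using power_eq_iff_eq_base[of k "norm z" 1] by simp
  qed
  show "algebraic_int z" if r: "root_of_unity z"
  proof -
    obtain k where k: "k > 0" "z ^ k = 1" using r by (auto simp: root_of_unity_def)
    show ?thesis
      by (rule algebraic_int_root[of 1 "monom 1 k"]) (use k in \<open>auto simp: poly_monom degree_monom_eq\<close>)
  qed
qed

lemma alg_hom_root_of_unity:
  assumes "alg_hom \<sigma>" "algebraic z"
  shows "root_of_unity (\<sigma> z) \<longleftrightarrow> root_of_unity z"
proof -
  have "\<sigma> z ^ k = 1 \<longleftrightarrow> z ^ k = 1" for k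
  proof -
    have "\<sigma> z ^ k = \<sigma> (z ^ k)" using alg_hom_power[OF assms] by simp
    moreover have "\<sigma> 1 = 1" using alg_hom_rat[OF assms(1)] by simp
    ultimately show ?thesis
      using alg_hom_inj[OF assms(1) algebraic_power[OF assms(2)], of 1 k] by auto
  qed
  then show ?thesis by (simp add: root_of_unity_def)
qed

lemma alg_hom_inverse:
  assumes "alg_hom \<sigma>" "algebraic x"
  shows "\<sigma> (inverse x) = inverse (\<sigma> x)"
proof (cases "x = 0")
  case False
  have "\<sigma> x * \<sigma> (inverse x) = \<sigma> (x * inverse x)"
    using assms by (intro alg_hom_mult[symmetric]) auto
  also have "\<dots> = 1" using False alg_hom_rat[OF assms(1), of 1] by simp
  finally show ?thesis by (metis inverse_unique)
qed (simp add: alg_hom_rat[OF assms(1)])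

lemma alg_hom_divide:
  assumes "alg_hom \<sigma>" "algebraic x" "algebraic y"
  shows "\<sigma> (x / y) = \<sigma> x / \<sigma> y" "algebraic (x / y)"
proof -
  have "algebraic (inverse y)" using assms(3) by auto
  then show "\<sigma> (x / y) = \<sigma> x / \<sigma> y" "algebraic (x / y)"
    using alg_hom_mult[OF assms(1,2), of "inverse y"] alg_hom_inverse[OF assms(1,3)] assms(2)
    by (auto simp: divide_inverse intro: algebraic_plus_times)
qed

text \<open>
  A finite set, depending only on \<open>n\<close>, that contains every root of unity which is a quotient of two
  roots of an irreducible integer polynomial of degree \<open>n\<close>, whatever its height.
\<close>

definition small_algebraic :: "nat \<Rightarrow> complex set" where
  "small_algebraic n = {z. \<exists>T::int poly. T \<noteq> 0 \<and> degree T \<le> n\<^sup>2 \<and>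
     (\<forall>i. \<bar>coeff T i\<bar> \<le> 2 ^ n\<^sup>2) \<and> poly (map_poly of_int T) z = 0}"

lemma card_bounded_int_polys:
  "finite {f::int poly. degree f \<le> d \<and> (\<forall>i. \<bar>coeff f i\<bar> \<le> int B)}"
  "card {f::int poly. degree f \<le> d \<and> (\<forall>i. \<bar>coeff f i\<bar> \<le> int B)} \<le> (2 * B + 1) ^ Suc d"
proof -
  let ?F = "{f::int poly. degree f \<le> d \<and> (\<forall>i. \<bar>coeff f i\<bar> \<le> int B)}"
  let ?L = "{xs. set xs \<subseteq> {- int B..int B} \<and> length xs = Suc d}"
  have fin: "finite ?L" by (intro finite_lists_length_eq) simp
  have card: "card ?L = (2 * B + 1) ^ Suc d"
  proof -
    have "card {- int B..int B} = 2 * B + 1" by simp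
    then show ?thesis by (simp only: card_lists_length_eq finite_atLeastAtMost_int)
  qed
  have sub: "?F \<subseteq> Poly ` ?L"
  proof
    fix f assume f: "f \<in> ?F"
    have "f = Poly (map (coeff f) [0..<Suc d])"
      using f by (intro poly_eqI) (auto simp: nth_default_def coeff_eq_0 simp del: upt_Suc)
    moreover have "map (coeff f) [0..<Suc d] \<in> ?L"
    proof -
      have "- int B \<le> coeff f i" "coeff f i \<le> int B" for i using f by (simp_all add: abs_le_iff minus_le_iff)
      then show ?thesis by (auto simp del: upt_Suc)
    qed
    ultimately show "f \<in> Poly ` ?L" by blast
  qed
  show "finite ?F" using finite_subset[OF sub] fin by blast
  show "card ?F \<le> (2 * B + 1) ^ Suc d"
    using card_mono[OF finite_imageI[OF fin] sub] card_image_le[OF fin, of Poly] unfolding card by (rule order_trans)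
qed

lemma finite_small_algebraic: "finite (small_algebraic n)"
proof -
  define F where "F = {f::int poly. degree f \<le> n\<^sup>2 \<and> (\<forall>i. \<bar>coeff f i\<bar> \<le> int (2 ^ n\<^sup>2))}"
  have "small_algebraic n \<subseteq> (\<Union>T\<in>F - {0}. {z. poly (map_poly of_int T) z = 0})"
    by (auto simp: small_algebraic_def F_def)
  moreover have "finite {z::complex. poly (map_poly of_int T) z = 0}" if "T \<in> F - {0}" for T :: "int poly"
    using that by (intro poly_roots_finite) auto
  moreover have "finite F" unfolding F_def by (rule card_bounded_int_polys(1))
  ultimately show ?thesis by (meson finite_Diff finite_UN_I finite_subset)
qed

lemma common_root_of_unity_exponent:
  assumes "finite Z"
  shows "\<exists>N>0. \<forall>z\<in>Z. root_of_unity z \<longrightarrow> z ^ N = 1"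
  using assms
proof (induction Z)
  case (insert z Z)
  then obtain N where N: "N > 0" "\<And>w. w \<in> Z \<Longrightarrow> root_of_unity w \<Longrightarrow> w ^ N = 1" by blast
  show ?case
  proof (cases "root_of_unity z")
    case True
    then obtain k where k: "k > 0" "z ^ k = 1" by (auto simp: root_of_unity_def)
    have "w ^ (N * k) = 1" if "w \<in> insert z Z" "root_of_unity w" for w
    proof (cases "w = z")
      case True
      then have "w ^ (N * k) = (z ^ k) ^ N" by (simp add: mult.commute flip: power_mult)
      then show ?thesis using k by simp
    next
      case False
      then show ?thesis using N(2)[of w] that by (simp add: power_mult)
    qed
    then show ?thesis using N(1) k(1) by (intro exI[of _ "N * k"]) auto
  next
    case False
    then show ?thesis using N by blast
  qed
qed (auto intro: exI[of _ 1])

lemma rat_int_poly: "map_poly of_rat (map_poly of_int f :: rat poly) = (map_poly of_int f :: complex poly)"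
  by (rule poly_eqI) (simp add: coeff_map_poly)

section \<open>The root set of one irreducible polynomial\<close>

context
  fixes f :: "int poly" and X :: "complex set" and a :: complex
  assumes irr: "irreducible_over_rat f" and deg: "degree f \<ge> 2"
  defines "X \<equiv> {x. poly (map_poly of_int f) x = 0}"
    and "a \<equiv> of_int (lead_coeff f)"
begin

lemma irreducible_rat_poly_f: "irreducible (map_poly of_int f :: rat poly)"
  using irr by (simp add: irreducible_over_rat_def)

lemma finite_root_set: "finite X"
  unfolding X_def using deg by (intro poly_roots_finite) auto

lemma mem_root_set: "x \<in> X \<longleftrightarrow> poly (map_poly of_rat (map_poly of_int f :: rat poly)) x = 0"
  by (simp add: X_def rat_int_poly)

lemma algebraic_root_set: "x \<in> X \<Longrightarrow> algebraic x"
  unfolding algebraic_iff_rat_poly using mem_root_set irreducible_rat_poly_f by (metis not_irreducible_zero)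

lemma split_over_root_set: "map_poly of_int f = smult a (\<Prod>x\<in>X. [:- x, 1:])"
proof -
  have "rsquarefree (map_poly of_int f :: complex poly)"
    unfolding rsquarefree_roots
  proof (intro allI notI)
    fix x :: complex
    assume x: "poly (map_poly of_int f) x = 0 \<and> poly (pderiv (map_poly of_int f)) x = 0"
    then obtain h where h: "map_poly of_int f = [:- x, 1:] * h" by (metis poly_eq_0_iff_dvd dvdE)
    have "poly (pderiv (map_poly of_int f)) x = poly h x" unfolding h pderiv_mult by (simp add: pderiv_pCons)
    then show False using irreducible_no_double_root[OF irreducible_rat_poly_f h[folded rat_int_poly]] x by simp
  qed
  from complex_poly_decompose_rsquarefree[OF this] show ?thesis by (simp add: X_def a_def)
qed

lemma card_root_set: "card X = degree f"
proof -
  have "a \<noteq> 0" using deg by (auto simp: a_def)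
  then have "degree (map_poly of_int f :: complex poly) = degree (\<Prod>x\<in>X. [:- x, 1:])"
    unfolding split_over_root_set by simp
  also have "\<dots> = card X" by (subst degree_prod_eq_sum_degree) auto
  finally show ?thesis by simp
qed

lemma zero_notin_root_set: "0 \<notin> X"
proof
  assume "0 \<in> X"
  then have "(map_poly of_int f :: rat poly) dvd [:0, 1:]"
    by (intro irreducible_dvd_of_common_root[OF irreducible_rat_poly_f, of 0]) (auto simp: mem_root_set)
  then have "degree (map_poly of_int f :: rat poly) \<le> 1"
    using dvd_imp_degree_le[of "map_poly of_int f" "[:0, 1:] :: rat poly"] by simp
  then show False using deg by simp
qed

lemma alg_hom_bij_root_set: "alg_hom \<sigma> \<Longrightarrow> bij_betw \<sigma> X X"
proof -
  assume s: "alg_hom \<sigma>"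
  have "inj_on \<sigma> X" using alg_hom_inj[OF s] algebraic_root_set by (intro inj_onI) blast
  moreover have "\<sigma> ` X \<subseteq> X" using alg_hom_root[OF s] algebraic_root_set by (auto simp: mem_root_set)
  ultimately show ?thesis using finite_root_set by (simp add: bij_betw_def endo_inj_surj)
qed

text \<open>Let \<open>T\<close> be the monic polynomial whose roots are all quotients of two roots
  of \<open>f\<close> that are roots of unity. Conjugations permute these quotients, so
  \<open>T\<close> has integer coefficients. There are at most \<open>(degree f)\<^sup>2\<close> of
  them, and they have modulus 1, so each coefficient is a sum of at most
  \<open>2 ^ (degree f)\<^sup>2\<close> terms of modulus 1. Neither bound involves the height of
  \<open>f\<close>.\<close>

lemma ratio_in_small_algebraic:
  assumes "x \<in> X" "y \<in> X" "root_of_unity (x / y)"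
  shows "x / y \<in> small_algebraic (degree f)"
proof -
  define E where "E = {z \<in> (\<lambda>(u, v). u / v) ` (X \<times> X). root_of_unity z}"
  have fE: "finite E" unfolding E_def using finite_root_set by simp
  have cE: "card E \<le> (degree f)\<^sup>2"
  proof -
    have "card E \<le> card ((\<lambda>(u, v). u / v) ` (X \<times> X))"
      unfolding E_def using finite_root_set by (intro card_mono) auto
    also have "\<dots> \<le> card (X \<times> X)" using finite_root_set by (intro card_image_le) auto
    finally show ?thesis by (simp add: card_cartesian_product card_root_set power2_eq_square)
  qed
  have aE: "algebraic z" if "z \<in> E" for z
    using that root_of_unity_simps(5) by (auto simp: E_def)
  have rat: "coeff (\<Prod>z\<in>E. [:- z, 1:]) k \<in> \<rat>" for k
  proof (rule rat_coeff_prod_linear[OF fE aE])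
    fix \<sigma> assume s: "alg_hom \<sigma>"
    have "\<sigma> ` E \<subseteq> E"
    proof
      fix w assume "w \<in> \<sigma> ` E"
      then obtain u v where w: "w = \<sigma> (u / v)" "u \<in> X" "v \<in> X" "root_of_unity (u / v)" by (auto simp: E_def)
      note d = alg_hom_divide[OF s algebraic_root_set[OF w(2)] algebraic_root_set[OF w(3)]]
      have "root_of_unity w" using w alg_hom_root_of_unity[OF s d(2)] by simp
      moreover have "\<sigma> u \<in> X" "\<sigma> v \<in> X" using alg_hom_bij_root_set[OF s] w by (auto simp: bij_betw_def)
      ultimately show "w \<in> E" unfolding E_def using w(1) d(1) by (auto intro!: image_eqI[of _ _ "(\<sigma> u, \<sigma> v)"])
    qed
    moreover have "inj_on \<sigma> E" using alg_hom_inj[OF s] aE by (intro inj_onI) blast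
    ultimately show "\<exists>\<pi>. bij_betw \<pi> E E \<and> (\<forall>i\<in>E. \<sigma> i = \<pi> i)"
      using fE by (intro exI[of _ \<sigma>]) (simp add: bij_betw_def endo_inj_surj)
  qed
  have "algebraic_int (coeff (smult 1 (\<Prod>z\<in>E. [:- z, 1:])) k)" for k
  proof (rule algebraic_int_coeff_prod_linear[OF fE])
    fix S assume "S \<subseteq> E"
    then have "algebraic_int (\<Prod>S)"
      by (intro algebraic_int_sum_prod(2) root_of_unity_simps(5)) (auto simp: E_def)
    then show "algebraic_int (1 * \<Prod>S)" by simp
  qed
  then have "coeff (\<Prod>z\<in>E. [:- z, 1:]) k \<in> \<int>" for k
    by (intro rational_algebraic_int_is_int[OF _ rat]) simp
  from int_poly_of_Ints_coeffs[OF this] obtain T where T: "map_poly of_int T = (\<Prod>z\<in>E. [:- z, 1:])" by blast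
  have "degree T = card E"
  proof -
    have "degree (map_poly of_int T :: complex poly) = card E"
      unfolding T by (subst degree_prod_eq_sum_degree) auto
    then show ?thesis by simp
  qed
  moreover have "\<bar>coeff T k\<bar> \<le> 2 ^ (degree f)\<^sup>2" for k
  proof -
    have "norm (coeff (smult 1 (\<Prod>z\<in>E. [:- z, 1:])) k) \<le> 2 ^ card E * 1"
    proof (rule norm_coeff_prod_linear_le[OF fE])
      fix S assume "S \<subseteq> E"
      then have "(\<Prod>z\<in>S. norm z) = 1" by (intro prod.neutral) (auto simp: E_def root_of_unity_simps)
      then show "norm (1 * \<Prod>S) \<le> 1" by (simp add: prod_norm[symmetric])
    qed
    also have "coeff (smult 1 (\<Prod>z\<in>E. [:- z, 1:])) k = of_int (coeff T k)"
      unfolding smult_1_left T[symmetric] by (simp add: coeff_map_poly)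
    finally have "real_of_int \<bar>coeff T k\<bar> \<le> 2 ^ card E" by simp
    also have "\<dots> \<le> 2 ^ (degree f)\<^sup>2" using cE by (intro power_increasing) auto
    finally have "real_of_int \<bar>coeff T k\<bar> \<le> real_of_int (2 ^ (degree f)\<^sup>2)" by simp
    then show ?thesis by (simp only: of_int_le_iff)
  qed
  moreover have "T \<noteq> 0"
  proof
    assume "T = 0"
    then have "(\<Prod>z\<in>E. [:- z, 1:]) = 0" using T by simp
    then show False using fE by (simp add: prod_zero_iff)
  qed
  moreover have "poly (map_poly of_int T) (x / y) = 0"
  proof -
    have "x / y \<in> E" using assms by (auto simp: E_def)
    then show ?thesis unfolding T poly_prod using fE by (auto simp: prod_zero_iff)
  qed
  ultimately show ?thesis using cE unfolding small_algebraic_def by auto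
qed

section \<open>Root classes and the polynomial of their products\<close>

definition root_class :: "complex \<Rightarrow> complex set" where
  "root_class x = {y \<in> X. root_of_unity (y / x)}"

lemma root_class_refl: "x \<in> X \<Longrightarrow> x \<in> root_class x"
  using zero_notin_root_set root_of_unity_simps(1) by (auto simp: root_class_def)

lemma finite_root_class: "finite (root_class x)"
  using finite_root_set by (simp add: root_class_def)

lemma root_class_eq:
  assumes "x \<in> X" "y \<in> root_class x"
  shows "root_class y = root_class x"
proof -
  have ne: "x \<noteq> 0" "y \<noteq> 0" and y: "y \<in> X" "root_of_unity (y / x)"
    using assms zero_notin_root_set by (auto simp: root_class_def)
  have "root_of_unity (z / y) \<longleftrightarrow> root_of_unity (z / x)" for z
  proof
    assume "root_of_unity (z / y)"
    from root_of_unity_simps(3)[OF this y(2)] show "root_of_unity (z / x)" using ne by simp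
  next
    assume z: "root_of_unity (z / x)"
    from root_of_unity_simps(3)[OF z root_of_unity_simps(2)[OF y(2)]]
    show "root_of_unity (z / y)" using ne by (simp add: field_simps)
  qed
  then show ?thesis by (simp add: root_class_def)
qed

lemma alg_hom_root_class:
  assumes s: "alg_hom \<sigma>" and x: "x \<in> X"
  shows "\<sigma> ` root_class x = root_class (\<sigma> x)"
proof -
  note bij = alg_hom_bij_root_set[OF s]
  have *: "root_of_unity (\<sigma> y / \<sigma> x) \<longleftrightarrow> root_of_unity (y / x)" if "y \<in> X" for y
    using alg_hom_divide[OF s algebraic_root_set[OF that] algebraic_root_set[OF x]] alg_hom_root_of_unity[OF s] by metis
  show ?thesis
  proof (intro equalityI subsetI)
    fix w assume "w \<in> \<sigma> ` root_class x"
    then show "w \<in> root_class (\<sigma> x)" using * bij by (auto simp: root_class_def bij_betw_def)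
  next
    fix w assume w: "w \<in> root_class (\<sigma> x)"
    then obtain y where "w = \<sigma> y" "y \<in> X" using bij by (auto simp: root_class_def bij_betw_def)
    then show "w \<in> \<sigma> ` root_class x" using w * by (auto simp: root_class_def)
  qed
qed

lemma card_root_class_eq:
  assumes "x \<in> X" "y \<in> X"
  shows "card (root_class x) = card (root_class y)"
proof -
  obtain \<sigma> where s: "alg_hom \<sigma>" "\<sigma> x = y"
    using conjugate_alg_hom[OF irreducible_rat_poly_f] assms by (auto simp: mem_root_set)
  have "inj_on \<sigma> (root_class x)"
    using alg_hom_bij_root_set[OF s(1)] by (auto simp: bij_betw_def root_class_def inj_on_def)
  then show ?thesis using alg_hom_root_class[OF s(1) assms(1)] s(2) by (metis card_image)
qed

lemma disjoint_root_classes: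
  "C \<in> root_class ` X \<Longrightarrow> D \<in> root_class ` X \<Longrightarrow> C \<noteq> D \<Longrightarrow> C \<inter> D = {}"
  using root_class_eq by blast

lemma Union_root_classes: "\<Union>(root_class ` X) = X"
  using root_class_refl by (auto simp: root_class_def)

lemma prod_Union_root_classes:
  assumes "S \<subseteq> root_class ` X"
  shows "(\<Prod>C\<in>S. \<Prod>C) = \<Prod>(\<Union>S)"
proof -
  have "\<Prod>(\<Union>S) = (prod \<circ> prod) (\<lambda>x. x) S"
  proof (rule prod.Union_disjoint)
    show "\<forall>C\<in>S. finite C" using assms finite_root_class by blast
    show "\<forall>C\<in>S. \<forall>D\<in>S. C \<noteq> D \<longrightarrow> C \<inter> D = {}"
    proof (intro ballI impI)
      fix C D assume "C \<in> S" "D \<in> S" "C \<noteq> D"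
      then show "C \<inter> D = {}" using assms by (intro disjoint_root_classes) auto
    qed
  qed
  then show ?thesis by simp
qed

text \<open>Classes are disjoint, so multiplying the products of the classes in \<open>S\<close>
  gives the product of the roots in \<open>\<Union>S\<close>, to which both the integrality result
  and the Landau bound for sets of roots apply. The factor \<open>2 ^ degree f\<close> bounds the
  number of sets \<open>S\<close>; integrality and rationality together give integer
  coefficients.\<close>

lemma class_polynomial_exists:
  assumes H: "\<And>i. \<bar>coeff f i\<bar> \<le> int H"
  shows "\<exists>h. map_poly of_int h = smult a (\<Prod>C\<in>root_class ` X. [:- \<Prod>C, 1:]) \<and>
     (\<forall>i. \<bar>coeff h i\<bar> \<le> int (2 ^ degree f * (degree f + 1) * H))"
proof -
  define I where "I = root_class ` X"
  define p where "p = smult a (\<Prod>C\<in>I. [:- \<Prod>C, 1:])"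
  have fI: "finite I" using finite_root_set by (simp add: I_def)
  have sub: "\<Union>S \<subseteq> X" if "S \<subseteq> I" for S using that Union_root_classes by (auto simp: I_def)
  have int: "algebraic_int (coeff p k)" for k
    unfolding p_def
  proof (rule algebraic_int_coeff_prod_linear[OF fI])
    fix S assume S: "S \<subseteq> I"
    have "algebraic_int (a * \<Prod>(\<Union>S))"
    proof (rule algebraic_int_lead_coeff_prod_subset[OF finite_root_set sub[OF S]])
      show "algebraic_int (coeff (smult a (\<Prod>x\<in>X. [:- x, 1:])) i)" for i
        unfolding split_over_root_set[symmetric] by (simp add: coeff_map_poly)
    qed
    then show "algebraic_int (a * (\<Prod>C\<in>S. \<Prod>C))" using prod_Union_root_classes S by (simp add: I_def)
  qed
  have rat: "coeff (\<Prod>C\<in>I. [:- \<Prod>C, 1:]) k \<in> \<rat>" for k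
  proof (rule rat_coeff_prod_linear[OF fI])
    show "algebraic (\<Prod>C)" if "C \<in> I" for C
      using that algebraic_root_set by (intro algebraic_prod) (auto simp: I_def root_class_def)
    fix \<sigma> assume s: "alg_hom \<sigma>"
    note bij = alg_hom_bij_root_set[OF s]
    have CX: "C \<subseteq> X" if "C \<in> I" for C using that by (auto simp: I_def root_class_def)
    have "(\<lambda>C. \<sigma> ` C) ` I \<subseteq> I"
    proof
      fix D assume "D \<in> (\<lambda>C. \<sigma> ` C) ` I"
      then obtain x where x: "x \<in> X" "D = root_class (\<sigma> x)" using alg_hom_root_class[OF s] by (auto simp: I_def)
      then have "\<sigma> x \<in> X" using bij by (auto simp: bij_betw_def)
      then show "D \<in> I" using x(2) by (simp add: I_def)
    qed
    moreover have "inj_on (\<lambda>C. \<sigma> ` C) I"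
      using CX bij by (intro inj_onI) (metis bij_betw_def inj_on_image_eq_iff)
    ultimately have "bij_betw (\<lambda>C. \<sigma> ` C) I I"
      using fI by (simp add: bij_betw_def endo_inj_surj)
    moreover have "\<sigma> (\<Prod>C) = \<Prod>(\<sigma> ` C)" if "C \<in> I" for C
    proof -
      have "\<sigma> (\<Prod>C) = (\<Prod>x\<in>C. \<sigma> x)"
        by (rule alg_hom_prod[OF s]) (use CX[OF that] algebraic_root_set in auto)
      also have "\<dots> = \<Prod>(\<sigma> ` C)"
        using CX[OF that] bij by (subst prod.reindex) (auto simp: bij_betw_def intro: inj_on_subset)
      finally show ?thesis .
    qed
    ultimately show "\<exists>\<pi>. bij_betw \<pi> I I \<and> (\<forall>C\<in>I. \<sigma> (\<Prod>C) = \<Prod>(\<pi> C))" by blast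
  qed
  have "coeff p k \<in> \<int>" for k
    using rat by (intro rational_algebraic_int_is_int[OF int]) (auto simp: p_def a_def intro: Rats_mult)
  from int_poly_of_Ints_coeffs[OF this] obtain h where h: "map_poly of_int h = p" by blast
  have "\<bar>coeff h k\<bar> \<le> int (2 ^ degree f * (degree f + 1) * H)" for k
  proof -
    have "norm (coeff p k) \<le> 2 ^ card I * ((real (degree f) + 1) * real H)"
      unfolding p_def
    proof (rule norm_coeff_prod_linear_le[OF fI])
      fix S assume S: "S \<subseteq> I"
      have "norm (a * \<Prod>(\<Union>S)) \<le> (real (degree f) + 1) * real H"
      proof (rule Landau_inequality_roots[OF finite_root_set sub[OF S] split_over_root_set])
        show "norm (coeff (map_poly of_int f :: complex poly) i) \<le> real H" for i
        proof -
          have "real_of_int \<bar>coeff f i\<bar> \<le> real_of_int (int H)" using H by (simp only: of_int_le_iff)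
          then show ?thesis by (simp add: coeff_map_poly)
        qed
      qed simp
      then show "norm (a * (\<Prod>C\<in>S. \<Prod>C)) \<le> (real (degree f) + 1) * real H"
        using prod_Union_root_classes S by (simp add: I_def)
    qed
    also have "\<dots> \<le> 2 ^ degree f * ((real (degree f) + 1) * real H)"
    proof -
      have "card I \<le> degree f" unfolding I_def card_root_set[symmetric] using finite_root_set by (rule card_image_le)
      then show ?thesis by (intro mult_right_mono power_increasing) auto
    qed
    also have "norm (coeff p k) = real_of_int \<bar>coeff h k\<bar>"
      unfolding h[symmetric] by (simp add: coeff_map_poly)
    also have "2 ^ degree f * ((real (degree f) + 1) * real H)
        = real_of_int (int (2 ^ degree f * (degree f + 1) * H))" by (simp add: algebra_simps)
    finally show ?thesis by (simp only: of_int_le_iff)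
  qed
  then show ?thesis using h unfolding p_def I_def by blast
qed

lemma irreducible_degenerate_class_data:
  assumes H: "\<And>i. \<bar>coeff f i\<bar> \<le> int H" and dg: "degenerate (map_poly of_int f)"
    and N: "\<forall>z\<in>small_algebraic (degree f). root_of_unity z \<longrightarrow> z ^ N = 1"
  shows "\<exists>h l x y. l dvd degree f \<and> l \<ge> 2 \<and> degree h = degree f div l \<and> lead_coeff h = lead_coeff f \<and>
     (\<forall>i. \<bar>coeff h i\<bar> \<le> int (2 ^ degree f * (degree f + 1) * H)) \<and> x \<in> X \<and>
     poly (map_poly of_int h) y = 0 \<and> x ^ (l * N) = y ^ N"
proof -
  obtain x u where xu: "x \<in> X" "u \<in> X" "u \<noteq> x" "root_of_unity (u / x)"
    using dg unfolding degenerate_def X_def root_of_unity_def by blast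
  define I where "I = root_class ` X"
  define l where "l = card (root_class x)"
  have fI: "finite I" using finite_root_set by (simp add: I_def)
  have "{x, u} \<subseteq> root_class x" using xu root_class_refl by (auto simp: root_class_def)
  then have "card {x, u} \<le> l" unfolding l_def by (rule card_mono[OF finite_root_class])
  then have l2: "l \<ge> 2" using xu(3) by simp
  have "l * card I = card (\<Union>I)"
  proof (rule card_partition[OF fI])
    show "finite (\<Union>I)" using finite_root_set Union_root_classes by (simp add: I_def)
    show "card C = l" if C: "C \<in> I" for C
    proof -
      obtain v where v: "v \<in> X" "C = root_class v" using C by (auto simp: I_def)
      show ?thesis unfolding l_def v(2) by (rule card_root_class_eq[OF v(1) xu(1)])
    qed
    show "C \<inter> D = {}" if "C \<in> I" "D \<in> I" "C \<noteq> D" for C D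
      using that disjoint_root_classes by (simp add: I_def)
  qed
  then have card_I: "l * card I = degree f" using Union_root_classes card_root_set by (simp add: I_def)
  obtain h where h: "map_poly of_int h = smult a (\<Prod>C\<in>I. [:- \<Prod>C, 1:])"
    "\<And>i. \<bar>coeff h i\<bar> \<le> int (2 ^ degree f * (degree f + 1) * H)"
    using class_polynomial_exists[OF H] unfolding I_def by blast
  have a0: "a \<noteq> 0" using deg by (auto simp: a_def)
  have "degree (map_poly of_int h :: complex poly) = degree (\<Prod>C\<in>I. [:- \<Prod>C, 1:])"
    unfolding h(1) using a0 by simp
  also have "\<dots> = card I" by (subst degree_prod_eq_sum_degree) auto
  finally have dh: "degree h = card I" by simp
  have "lead_coeff (map_poly of_int h :: complex poly) = a"
    unfolding h(1) lead_coeff_smult lead_coeff_prod by simp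
  then have lh: "lead_coeff h = lead_coeff f" by (simp add: a_def)
  define y where "y = \<Prod>(root_class x)"
  have "poly (map_poly of_int h) y = a * (\<Prod>C\<in>I. y - \<Prod>C)" unfolding h(1) by (simp add: poly_prod)
  also have "(\<Prod>C\<in>I. y - \<Prod>C) = 0"
    using fI xu(1) by (intro prod_zero) (auto simp: I_def y_def)
  finally have py: "poly (map_poly of_int h) y = 0" by simp
  have x0: "x \<noteq> 0" using xu(1) zero_notin_root_set by auto
  \<comment> \<open>Each \<open>v\<close> in the class is \<open>x\<close> times a root of unity of
    unknown order. The \<open>N\<close>-th power removes all these factors at once, leaving an
    equation with finitely many solutions \<open>x\<close> for given \<open>y\<close>.\<close>
  have "y = (\<Prod>v\<in>root_class x. x * (v / x))" unfolding y_def using x0 by simp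
  also have "\<dots> = x ^ l * (\<Prod>v\<in>root_class x. v / x)" unfolding prod.distrib l_def by simp
  finally have "y ^ N = x ^ (l * N) * (\<Prod>v\<in>root_class x. (v / x) ^ N)"
    by (simp only: power_mult_distrib power_mult prod_power_distrib)
  also have "(\<Prod>v\<in>root_class x. (v / x) ^ N) = 1"
    using N ratio_in_small_algebraic xu(1) by (intro prod.neutral) (auto simp: root_class_def)
  finally have xy: "x ^ (l * N) = y ^ N" by simp
  have "l dvd degree f" "degree h = degree f div l" using card_I dh l2 by (auto simp flip: card_I)
  then show ?thesis using l2 lh h(2) xu(1) py xy by blast
qed

end


section \<open>The upper bound\<close>

lemma power_eq_solutions:
  assumes "k > 0"
  shows "finite {x::complex. x ^ k = c}" "card {x::complex. x ^ k = c} \<le> k"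
proof -
  define q where "q = monom 1 k - [:c:]"
  have eq: "{x. x ^ k = c} = {x. poly q x = 0}" by (simp add: q_def poly_monom)
  have "coeff q k = 1" using assms by (simp add: q_def coeff_pCons split: nat.splits)
  then have q0: "q \<noteq> 0" by auto
  have "degree q \<le> k" unfolding q_def by (intro degree_diff_le) (simp_all add: degree_monom_le)
  then show "finite {x::complex. x ^ k = c}" "card {x::complex. x ^ k = c} \<le> k"
    unfolding eq using poly_roots_finite[OF q0] card_poly_roots_bound[OF q0] by auto
qed

text \<open>A common root fixes an irreducible polynomial only up to a rational factor. As the
  polynomials need not be primitive, this factor is pinned down by the leading coefficient.\<close>

lemma irreducible_eq_of_common_root:
  fixes f g :: "int poly" and x :: complex
  assumes f: "irreducible_over_rat f" and g: "irreducible_over_rat g"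
    and deg: "degree f = degree g" and lead: "lead_coeff f = lead_coeff g"
    and x: "poly (map_poly of_int f) x = 0" "poly (map_poly of_int g) x = 0"
  shows "f = g"
proof -
  have f0: "f \<noteq> 0" using f by (auto simp: irreducible_over_rat_def)
  have "(map_poly of_int f :: rat poly) dvd map_poly of_int g"
    using f x by (intro irreducible_dvd_of_common_root[of _ x])
      (simp_all add: irreducible_over_rat_def rat_int_poly)
  then obtain c where c: "map_poly of_int g = map_poly of_int f * (c :: rat poly)" by (elim dvdE)
  have "g \<noteq> 0" using f0 lead by auto
  then have c0: "c \<noteq> 0" using c by auto
  have "degree (map_poly of_int g :: rat poly) = degree (map_poly of_int f :: rat poly) + degree c"
    unfolding c using f0 c0 by (intro degree_mult_eq) auto
  then have "degree c = 0" using deg by simp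
  then obtain b where b: "c = [:b:]" by (rule degree_eq_zeroE)
  have "lead_coeff (map_poly of_int g :: rat poly) = lead_coeff (map_poly of_int f :: rat poly) * lead_coeff c"
    unfolding c by (rule lead_coeff_mult)
  then have "b = 1" using b lead f0 \<open>g \<noteq> 0\<close> by simp
  then have "map_poly of_int g = (map_poly of_int f :: rat poly)" using c b by simp
  then show ?thesis by simp
qed

lemma least_prime_divisor:
  fixes n p :: nat
  assumes "n \<ge> 2" "p = (LEAST q. prime q \<and> q dvd n)"
  shows "prime p" "p dvd n"
proof -
  have "\<exists>q. prime q \<and> q dvd n" using prime_factor_nat[of n] assms(1) by auto
  then have "prime p \<and> p dvd n" unfolding assms(2) by (rule LeastI_ex)
  then show "prime p" "p dvd n" by auto
qed

text \<open>The map \<open>\<phi>\<close> sending \<open>f\<close> to \<open>(h, x)\<close> is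
  injective, since \<open>h\<close> has the leading coefficient of \<open>f\<close> and
  \<open>x\<close> is a root of \<open>f\<close>. For given \<open>h\<close> there are at most
  \<open>n\<close> roots \<open>y\<close>, \<open>n\<close> values of \<open>l\<close>, and
  \<open>l * N \<le> n * N\<close> solutions \<open>x\<close>; this is the factor
  \<open>n * (n * (n * N))\<close>. Uniting over all \<open>l\<close> avoids a separate count for
  each class size.\<close>

lemma card_irreducible_degenerate_le:
  assumes n: "n \<ge> 2" and p: "p = (LEAST q. prime q \<and> q dvd n)"
    and N: "N > 0" "\<forall>z\<in>small_algebraic n. root_of_unity z \<longrightarrow> z ^ N = 1"
  shows "I_star n H \<le> (2 * (2 ^ n * (n + 1) * H) + 1) ^ Suc (n div p) * (n * (n * (n * N)))"
proof -
  define B where "B = 2 ^ n * (n + 1) * H"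
  define \<H> where "\<H> = {h::int poly. degree h \<le> n div p \<and> (\<forall>i. \<bar>coeff h i\<bar> \<le> int B)}"
  define F where "F = {f \<in> S_star n H. irreducible_over_rat f}"
  define R where "R h = {x::complex. \<exists>y l. poly (map_poly of_int h) y = 0 \<and> l \<in> {1..n} \<and> x ^ (l * N) = y ^ N}"
    for h :: "int poly"
  have finH: "finite \<H>" unfolding \<H>_def by (rule card_bounded_int_polys(1))
  have R: "finite (R h) \<and> card (R h) \<le> n * (n * (n * N))" if h: "h \<in> \<H> - {0}" for h
  proof -
    define Y where "Y = {y::complex. poly (map_poly of_int h) y = 0}"
    have h0: "map_poly of_int h \<noteq> (0 :: complex poly)" using h by simp
    have fY: "finite Y" unfolding Y_def by (rule poly_roots_finite[OF h0])
    have "card Y \<le> degree (map_poly of_int h :: complex poly)"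
      unfolding Y_def by (rule card_poly_roots_bound[OF h0])
    also have "\<dots> \<le> n" using h by (simp add: \<H>_def) (meson div_le_dividend order_trans)
    finally have cY: "card Y \<le> n" .
    have eq: "R h = (\<Union>y\<in>Y. \<Union>l\<in>{1..n}. {x. x ^ (l * N) = y ^ N})"
      unfolding R_def Y_def by blast
    have pos: "l * N > 0" if "l \<in> {1..n}" for l using that N(1) by simp
    have le: "card (\<Union>l\<in>{1..n}. {x::complex. x ^ (l * N) = y ^ N}) \<le> n * (n * N)" for y
    proof -
      have "card (\<Union>l\<in>{1..n}. {x::complex. x ^ (l * N) = y ^ N})
          \<le> (\<Sum>l\<in>{1..n}. card {x::complex. x ^ (l * N) = y ^ N})"
        by (rule card_UN_le) simp
      also have "\<dots> \<le> (\<Sum>l\<in>{1..n}. n * N)"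
      proof (rule sum_mono)
        fix l assume l: "l \<in> {1..n}"
        have "card {x::complex. x ^ (l * N) = y ^ N} \<le> l * N"
          by (rule power_eq_solutions(2)[OF pos[OF l]])
        also have "\<dots> \<le> n * N" using l by simp
        finally show "card {x::complex. x ^ (l * N) = y ^ N} \<le> n * N" .
      qed
      finally show ?thesis by simp
    qed
    have "(\<Sum>y\<in>Y. card (\<Union>l\<in>{1..n}. {x::complex. x ^ (l * N) = y ^ N})) \<le> (\<Sum>y\<in>Y. n * (n * N))"
      by (rule sum_mono) (rule le)
    then have "(\<Sum>y\<in>Y. card (\<Union>l\<in>{1..n}. {x::complex. x ^ (l * N) = y ^ N})) \<le> card Y * (n * (n * N))"
      by simp
    moreover have "card (R h) \<le> (\<Sum>y\<in>Y. card (\<Union>l\<in>{1..n}. {x::complex. x ^ (l * N) = y ^ N}))"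
      unfolding eq by (rule card_UN_le[OF fY])
    moreover have "card Y * (n * (n * N)) \<le> n * (n * (n * N))" using cY by (rule mult_right_mono) simp
    ultimately have "card (R h) \<le> n * (n * (n * N))" by linarith
    moreover have "finite (R h)"
      unfolding eq by (intro finite_UN_I fY power_eq_solutions(1) pos) auto
    ultimately show ?thesis by blast
  qed
  have "\<forall>f\<in>F. \<exists>hx. fst hx \<in> \<H> - {0} \<and> snd hx \<in> R (fst hx) \<and> lead_coeff (fst hx) = lead_coeff f \<and>
      poly (map_poly of_int f) (snd hx) = 0"
  proof
    fix f assume f: "f \<in> F"
    have fn: "degree f = n" "f \<noteq> 0" "degenerate (map_poly of_int f)" "irreducible_over_rat f"
      using f n by (auto simp: F_def S_star_def)
    have cf: "\<bar>coeff f i\<bar> \<le> int H" for i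
      using f by (cases "i \<le> n") (auto simp: F_def S_star_def coeff_eq_0)
    have d2: "degree f \<ge> 2" using fn(1) n by simp
    have N': "\<forall>z\<in>small_algebraic (degree f). root_of_unity z \<longrightarrow> z ^ N = 1"
      using N(2) fn(1) by simp
    from irreducible_degenerate_class_data[OF fn(4) d2 cf fn(3) N', unfolded mem_Collect_eq]
    obtain h l and x y :: complex where h': "l dvd degree f" "l \<ge> 2" "degree h = degree f div l" "lead_coeff h = lead_coeff f"
      "\<forall>i. \<bar>coeff h i\<bar> \<le> int (2 ^ degree f * (degree f + 1) * H)"
      "poly (map_poly of_int f) x = 0" "poly (map_poly of_int h) y = 0" "x ^ (l * N) = y ^ N"
      by blast
    have h: "l dvd n" "l \<ge> 2" "degree h = n div l" "lead_coeff h = lead_coeff f" "\<And>i. \<bar>coeff h i\<bar> \<le> int B"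
      using h'(1-5) unfolding fn(1) B_def by auto
    have "p \<le> l"
    proof -
      \<comment> \<open>A prime factor of \<open>l\<close> also divides \<open>n\<close>, so it lies
        between \<open>p\<close> and \<open>l\<close>.\<close>
      obtain q where q: "prime q" "q dvd l" using h(2) prime_factor_nat[of l] by auto
      have "p \<le> q" unfolding p by (rule Least_le, rule conjI[OF q(1) dvd_trans[OF q(2) h(1)]])
      also have "q \<le> l" using q(2) h(2) by (intro dvd_imp_le) auto
      finally show ?thesis .
    qed
    moreover have "p > 0" using least_prime_divisor(1)[OF n p] by (rule prime_gt_0_nat)
    ultimately have "degree h \<le> n div p" unfolding h(3) by (intro div_le_mono2)
    moreover have "h \<noteq> 0" using h(4) fn(2) by auto
    ultimately have "h \<in> \<H> - {0}" using h(5) by (simp add: \<H>_def)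
    moreover have "l \<le> n" using h(1) n by (intro dvd_imp_le) auto
    then have "l \<in> {1..n}" using h(2) by simp
    then have "x \<in> R h" unfolding R_def mem_Collect_eq using h'(7,8) by blast
    ultimately show "\<exists>hx. fst hx \<in> \<H> - {0} \<and> snd hx \<in> R (fst hx) \<and>
        lead_coeff (fst hx) = lead_coeff f \<and> poly (map_poly of_int f) (snd hx) = 0"
      using h(4) h'(6) by (intro exI[of _ "(h, x)"]) (simp only: fst_conv snd_conv)
  qed
  from bchoice[OF this] obtain \<phi> where \<phi>: "\<forall>f\<in>F. fst (\<phi> f) \<in> \<H> - {0} \<and> snd (\<phi> f) \<in> R (fst (\<phi> f)) \<and>
      lead_coeff (fst (\<phi> f)) = lead_coeff f \<and> poly (map_poly of_int f) (snd (\<phi> f)) = 0" ..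
  have \<phi>: "fst (\<phi> f) \<in> \<H> - {0}" "snd (\<phi> f) \<in> R (fst (\<phi> f))"
    "lead_coeff (fst (\<phi> f)) = lead_coeff f" "poly (map_poly of_int f) (snd (\<phi> f)) = 0" if "f \<in> F" for f
    using bspec[OF \<phi> that] by blast+
  have inj: "inj_on \<phi> F"
  proof (rule inj_onI)
    fix f g assume fg: "f \<in> F" "g \<in> F" "\<phi> f = \<phi> g"
    show "f = g"
    proof (rule irreducible_eq_of_common_root)
      show "irreducible_over_rat f" "irreducible_over_rat g" "degree f = degree g"
        using fg by (auto simp: F_def S_star_def)
      show "lead_coeff f = lead_coeff g" using \<phi>(3)[OF fg(1)] \<phi>(3)[OF fg(2)] fg(3) by simp
      show "poly (map_poly of_int f) (snd (\<phi> f)) = 0" by (rule \<phi>(4)[OF fg(1)])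
      show "poly (map_poly of_int g) (snd (\<phi> f)) = 0" using \<phi>(4)[OF fg(2)] fg(3) by simp
    qed
  qed
  have "\<phi> ` F \<subseteq> Sigma (\<H> - {0}) R"
  proof
    fix z assume "z \<in> \<phi> ` F"
    then obtain f where f: "z = \<phi> f" "f \<in> F" by blast
    have "(fst (\<phi> f), snd (\<phi> f)) \<in> Sigma (\<H> - {0}) R" by (intro SigmaI \<phi> f)
    then show "z \<in> Sigma (\<H> - {0}) R" by (simp add: f)
  qed
  moreover have "finite (Sigma (\<H> - {0}) R)" using finH R by (intro finite_SigmaI) auto
  ultimately have "card F \<le> card (Sigma (\<H> - {0}) R)"
    using card_image[OF inj] by (metis card_mono)
  also have "\<dots> = (\<Sum>h\<in>\<H> - {0}. card (R h))" using finH R by (intro card_SigmaI) auto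
  also have "\<dots> \<le> (\<Sum>h\<in>\<H> - {0}. n * (n * (n * N)))" using R by (intro sum_mono) auto
  also have "\<dots> = card (\<H> - {0}) * (n * (n * (n * N)))" by simp
  also have "\<dots> \<le> (2 * B + 1) ^ Suc (n div p) * (n * (n * (n * N)))"
  proof (rule mult_right_mono)
    have "card (\<H> - {0}) \<le> card \<H>" using finH by (intro card_mono) auto
    also have "\<dots> \<le> (2 * B + 1) ^ Suc (n div p)" unfolding \<H>_def by (rule card_bounded_int_polys(2))
    finally show "card (\<H> - {0}) \<le> (2 * B + 1) ^ Suc (n div p)" .
  qed simp
  finally show ?thesis by (simp only: I_star_def F_def B_def)
qed

lemma powr_one_plus_quotient:
  fixes n p H :: nat
  assumes "n \<ge> 2" "p = (LEAST q. prime q \<and> q dvd n)" "H \<ge> 1"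
  shows "real H powr (1 + real n / real p) = real H ^ Suc (n div p)"
proof -
  have eq: "1 + real n / real p = real (Suc (n div p))"
    using least_prime_divisor[OF assms(1,2)] by (simp add: real_of_nat_div)
  have "real H > 0" using assms(3) by simp
  then show ?thesis unfolding eq by (rule powr_realpow)
qed

lemma I_star_upper_bound:
  assumes n: "n \<ge> 2" and p: "p = (LEAST q. prime q \<and> q dvd n)"
  shows "\<exists>C::real. C > 0 \<and> (\<forall>H\<ge>1. real (I_star n H) \<le> C * real H powr (1 + real n / real p))"
proof -
  obtain N where N: "N > 0" "\<forall>z\<in>small_algebraic n. root_of_unity z \<longrightarrow> z ^ N = 1"
    using common_root_of_unity_exponent[OF finite_small_algebraic[of n]] by blast
  define A where "A = (3 * (2 ^ n * (n + 1))) ^ Suc (n div p) * (n * (n * (n * N)))"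
  have "real (I_star n H) \<le> real A * real H powr (1 + real n / real p)" if H: "H \<ge> 1" for H
  proof -
    have "I_star n H \<le> (2 * (2 ^ n * (n + 1) * H) + 1) ^ Suc (n div p) * (n * (n * (n * N)))"
      by (rule card_irreducible_degenerate_le[OF n p N])
    also have "\<dots> \<le> (3 * (2 ^ n * (n + 1)) * H) ^ Suc (n div p) * (n * (n * (n * N)))"
    proof (intro mult_right_mono power_mono)
      \<comment> \<open>Since \<open>H \<ge> 1\<close>, the summand 1 is absorbed by raising the
        factor 2 to 3, which makes the bound a pure power of \<open>H\<close>.\<close>
      have "2 ^ n * (n + 1) * H \<ge> 1" using H by (simp add: Suc_le_eq)
      then show "2 * (2 ^ n * (n + 1) * H) + 1 \<le> 3 * (2 ^ n * (n + 1)) * H" by linarith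
    qed simp_all
    also have "\<dots> = A * H ^ Suc (n div p)" unfolding A_def power_mult_distrib by (simp only: mult_ac)
    finally have "real (I_star n H) \<le> real (A * H ^ Suc (n div p))" by (rule of_nat_mono)
    then show ?thesis unfolding powr_one_plus_quotient[OF n p H] by simp
  qed
  moreover have "A > 0" using n N(1) unfolding A_def by (intro mult_pos_pos zero_less_power) auto
  then have "real A > 0" by simp
  ultimately show ?thesis by blast
qed


section \<open>The lower bound\<close>

lemma irreducible_over_ratI:
  assumes "degree f > 0" and nofac: "\<And>g h. f = g * h \<Longrightarrow> degree g > 0 \<Longrightarrow> degree h > 0 \<Longrightarrow> False"
  shows "irreducible_over_rat f"
  unfolding irreducible_over_rat_def
proof (rule irreducibleI)
  have f0: "f \<noteq> 0" using assms(1) by auto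
  show "(map_poly of_int f :: rat poly) \<noteq> 0" using f0 by simp
  show "\<not> is_unit (map_poly of_int f :: rat poly)" using assms(1) by (simp add: is_unit_iff_degree f0)
  fix g h :: "rat poly" assume gh: "map_poly of_int f = g * h"
  show "is_unit g \<or> is_unit h"
  proof (rule ccontr)
    assume u: "\<not> (is_unit g \<or> is_unit h)"
    have "g \<noteq> 0" "h \<noteq> 0" using gh f0 by auto
    then have d: "degree g > 0" "degree h > 0" using u by (auto simp: is_unit_iff_degree)
    \<comment> \<open>Gauss's lemma: a rational factorization lifts to an integral one with the same
      degrees. Only factors of positive degree are relevant, so a content of \<open>f\<close> does
      no harm.\<close>
    obtain g' h' where "f = g' * h'" "degree g' = degree g" "degree h' = degree h"
      using rat_to_int_factor[OF gh] by blast
    then show False using nofac[of g' h'] d by simp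
  qed
qed

text \<open>In \<open>main\<close>, \<open>g\<close> is the factor whose constant coefficient is
  divisible by \<open>q\<close>; then that of \<open>h\<close> is not. At the first index
  \<open>i\<close> with \<open>q\<close> not dividing \<open>coeff g i\<close>, exactly one term of
  the convolution \<open>coeff f i\<close> escapes \<open>q\<close>, although
  \<open>i \<le> degree g < degree f\<close>.\<close>

lemma Eisenstein_irreducible:
  fixes f :: "int poly" and q :: int
  assumes q: "prime q" and n: "degree f > 0" and lead: "\<not> q dvd lead_coeff f"
    and low: "\<And>i. i < degree f \<Longrightarrow> q dvd coeff f i" and const: "\<not> q\<^sup>2 dvd coeff f 0"
  shows "irreducible_over_rat f"
proof (rule irreducible_over_ratI[OF n])
  have main: False if f: "f = g * h" and d: "degree g > 0" "degree h > 0" and g0: "q dvd coeff g 0" for g h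
  proof -
    have f0: "f \<noteq> 0" using n by auto
    have df: "degree f = degree g + degree h" using f f0 degree_mult_eq[of g h] by auto
    have "coeff f 0 = coeff g 0 * coeff h 0" by (simp add: f coeff_mult_0)
    then have h0: "\<not> q dvd coeff h 0" using const g0 by (auto simp: power2_eq_square mult_dvd_mono)
    have "lead_coeff f = lead_coeff g * lead_coeff h" unfolding f by (rule lead_coeff_mult)
    then have lg: "\<not> q dvd coeff g (degree g)" using lead by auto
    define i where "i = (LEAST i. \<not> q dvd coeff g i)"
    have i: "\<not> q dvd coeff g i" unfolding i_def by (rule LeastI[of "\<lambda>i. \<not> q dvd coeff g i", OF lg])
    have less: "q dvd coeff g j" if "j < i" for j using not_less_Least[OF that[unfolded i_def]] by simp
    have "i \<le> degree g" unfolding i_def by (rule Least_le[of "\<lambda>i. \<not> q dvd coeff g i", OF lg])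
    then have "q dvd coeff f i" using low df d by simp
    also have "coeff f i = (\<Sum>j<i. coeff g j * coeff h (i - j)) + coeff g i * coeff h 0"
      unfolding f coeff_mult by (simp add: lessThan_Suc_atMost[symmetric])
    finally have "q dvd (\<Sum>j<i. coeff g j * coeff h (i - j)) + coeff g i * coeff h 0" .
    moreover have "q dvd (\<Sum>j<i. coeff g j * coeff h (i - j))" using less by (intro dvd_sum) simp
    ultimately have "q dvd coeff g i * coeff h 0" by (metis dvd_add_right_iff)
    then show False using i h0 q by (simp add: prime_dvd_mult_iff)
  qed
  fix g h assume f: "f = g * h" and d: "degree g > 0" "degree h > 0"
  have "q dvd coeff f 0" using low n by simp
  then have "q dvd coeff g 0 \<or> q dvd coeff h 0" using q by (simp add: f coeff_mult_0 prime_dvd_mult_iff)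
  then show False using main[of g h] main[of h g] f d by (auto simp: mult.commute)
qed

lemma coeff_pcompose_monom:
  "p > 0 \<Longrightarrow> coeff (pcompose g (monom 1 p)) i = (if p dvd i then coeff g (i div p) else (0::int))"
proof (induction g arbitrary: i)
  case (pCons a g)
  show ?case
  proof (cases "i < p")
    case True
    then show ?thesis using pCons.prems
      by (auto simp: pcompose_pCons coeff_monom_mult coeff_pCons dvd_imp_le split: nat.splits)
  next
    case False
    then obtain k where k: "i = k + p" by (metis le_add_diff_inverse2 not_less)
    then show ?thesis using pCons by (auto simp: pcompose_pCons coeff_monom_mult coeff_pCons split: nat.splits)
  qed
qed simp

lemma complex_nth_root_exists: "p > 0 \<Longrightarrow> \<exists>x::complex. x ^ p = y"
proof -
  assume p: "p > 0"
  have "degree (monom 1 p - [:y:]) = p"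
    using p by (intro antisym degree_diff_le le_degree) (auto simp: degree_monom_le coeff_pCons split: nat.splits)
  then have "\<not> constant (poly (monom 1 p - [:y:]))" using p by (simp add: constant_degree)
  from fundamental_theorem_of_algebra[OF this] show ?thesis by (auto simp: poly_monom)
qed

text \<open>The roots of \<open>g(X\<^sup>p)\<close> are closed under multiplication by a
  \<open>p\<close>-th root of unity \<open>w\<close>. The constant coefficient keeps the root
  \<open>x\<close> away from 0, so \<open>w * x\<close> is a second one.\<close>

lemma degenerate_pcompose_monom:
  fixes g :: "int poly"
  assumes p: "p \<ge> 2" and g: "degree g > 0" "coeff g 0 \<noteq> 0"
  shows "degenerate (map_poly of_int (pcompose g (monom 1 p)))"
proof -
  have ev: "poly (map_poly of_int (pcompose g (monom 1 p))) x = poly (map_poly of_int g) (x ^ p)" for x :: complex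
  proof (induction g)
    case (pCons a g)
    have "map_poly of_int [:a:] = [:of_int a :: complex:]"
      by (rule poly_eqI) (simp add: coeff_map_poly coeff_pCons split: nat.splits)
    then have "map_poly of_int (pcompose (pCons a g) (monom 1 p))
        = [:of_int a:] + monom 1 p * (map_poly of_int (pcompose g (monom 1 p)) :: complex poly)"
      by (simp add: pcompose_pCons of_int_poly_hom.hom_add of_int_poly_hom.hom_mult)
    then show ?case using pCons by (simp add: poly_monom)
  qed simp
  have "\<not> constant (poly (map_poly of_int g :: complex poly))" using g(1) by (simp add: constant_degree)
  then obtain y :: complex where y: "poly (map_poly of_int g) y = 0" using fundamental_theorem_of_algebra by blast
  have y0: "y \<noteq> 0" using y g(2) by (auto simp: poly_0_coeff_0 coeff_map_poly)
  obtain x where x: "x ^ p = y" using complex_nth_root_exists[of p y] p by auto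
  define w where "w = cis (2 * pi / real p)"
  have wp: "w ^ p = 1" using p by (simp add: w_def DeMoivre)
  have w1: "w \<noteq> 1"
  proof
    assume "w = 1"
    then have "cos (2 * pi / real p) = 1" by (simp add: w_def complex_eq_iff)
    \<comment> \<open>The angle is positive and, as \<open>p \<ge> 2\<close>, at most
      \<open>pi\<close>, where the cosine is strictly decreasing.\<close>
    moreover have "cos (2 * pi / real p) < cos 0"
      using p by (intro cos_monotone_0_pi) (auto simp: field_simps)
    ultimately show False by simp
  qed
  have x0: "x \<noteq> 0" using x y0 p by (auto simp: power_0_left)
  have "poly (map_poly of_int (pcompose g (monom 1 p))) (w * x) = 0"
    "poly (map_poly of_int (pcompose g (monom 1 p))) x = 0"
    using x y wp by (simp_all add: ev power_mult_distrib)
  moreover have "w * x \<noteq> x" using w1 x0 by simp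
  moreover have "p > 0 \<and> (w * x / x) ^ p = 1" using x0 wp p by simp
  ultimately show ?thesis unfolding degenerate_def using x0 by blast
qed

lemma I_star_lower_bound_ge_2:
  fixes n p H :: nat
  assumes n: "n \<ge> 2" and p: "p = (LEAST q. prime q \<and> q dvd n)" and H: "H \<ge> 2"
  shows "((H + 2) div 4) ^ Suc (n div p) \<le> I_star n H"
proof -
  \<comment> \<open>\<open>K\<close> is the largest integer with \<open>4 * K - 2 \<le> H\<close>.
    Hence for \<open>u\<close> in \<open>{1..K}\<close> both \<open>4 * u - 2\<close> and
    \<open>4 * u - 3\<close> lie between 1 and \<open>H\<close>.\<close>
  define m K where "m = n div p" and "K = (H + 2) div 4"
  have pp: "prime p" "p dvd n" using least_prime_divisor[OF n p] by auto
  have p2: "p \<ge> 2" using pp(1) by (rule prime_ge_2_nat)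
  have mp: "m * p = n" using pp(2) by (simp add: m_def)
  have m1: "m > 0" using mp n by (cases m) auto
  have K: "4 * K \<le> H + 2" by (simp add: K_def)
  define g where "g u = (\<Sum>j<m. monom (4 * int (u j) - 2) j) + monom (4 * int (u m) - 3) m" for u :: "nat \<Rightarrow> nat"
  define U where "U = PiE {..m} (\<lambda>_. {1..K})"
  have cg: "coeff (g u) j = (if j < m then 4 * int (u j) - 2 else if j = m then 4 * int (u m) - 3 else 0)" for u j
    by (simp add: g_def coeff_sum)
  have lead_ne: "4 * int k - 3 \<noteq> 0" "4 * int k - 2 \<noteq> 0" for k by presburger+
  have dg: "degree (g u) = m" for u
  proof (rule antisym)
    show "degree (g u) \<le> m" by (rule degree_le) (simp add: cg)
    have "coeff (g u) m \<noteq> 0" using lead_ne(1)[of "u m"] by (simp add: cg)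
    then show "m \<le> degree (g u)" by (rule le_degree)
  qed
  define F where "F u = pcompose (g u) (monom 1 p)" for u
  have cF: "coeff (F u) i = (if p dvd i then coeff (g u) (i div p) else 0)" for u i
    unfolding F_def using p2 by (intro coeff_pcompose_monom) auto
  have dF: "degree (F u) = n" for u
    unfolding F_def degree_pcompose dg by (simp add: degree_monom_eq mp)
  have nm: "n div p = m" "p dvd n" using pp(2) by (auto simp: m_def)
  have mem: "F u \<in> {f \<in> S_star n H. irreducible_over_rat f}" if u: "u \<in> U" for u
  proof -
    have u1: "1 \<le> u j" "u j \<le> K" if "j \<le> m" for j using u that by (auto simp: U_def PiE_def Pi_def)
    have bound: "\<bar>coeff (F u) i\<bar> \<le> int H" for i
    proof -
      have "\<bar>coeff (g u) j\<bar> \<le> int H" for j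
        using u1[of j] u1[of m] K by (auto simp: cg)
      then show ?thesis by (simp add: cF)
    qed
    have lead: "coeff (F u) n = 4 * int (u m) - 3" by (simp add: cF nm cg)
    have "coeff (g u) 0 \<noteq> 0" using lead_ne(2)[of "u 0"] m1 by (simp add: cg)
    then have dgn: "degenerate (map_poly of_int (F u))"
      unfolding F_def using p2 m1 by (intro degenerate_pcompose_monom) (auto simp: dg)
    have "irreducible_over_rat (F u)"
    proof (rule Eisenstein_irreducible[of 2])
      show "degree (F u) > 0" using dF n by simp
      show "\<not> 2 dvd lead_coeff (F u)" unfolding dF lead by presburger
      show "2 dvd coeff (F u) i" if "i < degree (F u)" for i
      proof (cases "p dvd i")
        case True
        then have "i div p < m" using that p2 unfolding dF by (metis mp dvd_div_mult_self mult_less_cancel2)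
        then show ?thesis using True by (simp add: cF cg)
      qed (simp add: cF)
      have "coeff (F u) 0 = 4 * int (u 0) - 2" using m1 by (simp add: cF cg)
      then show "\<not> 2\<^sup>2 dvd coeff (F u) 0" by (simp only: power2_eq_square) presburger
    qed simp
    then show ?thesis using dF lead lead_ne dgn bound by (simp add: S_star_def)
  qed
  have inj: "inj_on F U"
  proof (rule inj_onI)
    fix u v assume uv: "u \<in> U" "v \<in> U" "F u = F v"
    show "u = v"
    proof (rule PiE_ext)
      show "u \<in> PiE {..m} (\<lambda>_. {1..K})" "v \<in> PiE {..m} (\<lambda>_. {1..K})" using uv by (simp_all add: U_def)
      fix j assume j: "j \<in> {..m}"
      have "coeff (F u) (j * p) = coeff (F v) (j * p)" using uv(3) by simp
      then have "coeff (g u) j = coeff (g v) j" using p2 by (simp add: cF)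
      then show "u j = v j" using j by (cases "j = m") (auto simp: cg)
    qed
  qed
  have "K ^ Suc m = card U" by (simp add: U_def card_PiE)
  also have "\<dots> = card (F ` U)" by (rule card_image[OF inj, symmetric])
  also have "\<dots> \<le> card {f \<in> S_star n H. irreducible_over_rat f}"
    using mem finite_S_star by (intro card_mono) auto
  finally show ?thesis by (simp add: I_star_def m_def K_def)
qed

section \<open>Height 1: irreducible trinomials and \<open>X\<^sup>2 + 1\<close>\<close>

lemma trinomial_no_reciprocal_root:
  fixes z :: complex
  assumes z: "z \<noteq> 0" "p dvd n" "z ^ n = z ^ p + 1" "inverse z ^ n = inverse z ^ p + 1"
  shows False
proof -
  obtain m where m: "n = p * m" using z(2) by (elim dvdE)
  \<comment> \<open>In terms of \<open>y\<close> the two equations are \<open>y ^ m = y + 1\<close>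
    and its analogue for \<open>inverse y\<close>. Their product gives
    \<open>y\<^sup>2 + y + 1 = 0\<close>, so \<open>y ^ 3 = 1\<close> and
    \<open>y ^ m = - y\<^sup>2\<close>, and cubing gives \<open>1 = -1\<close>. Divisibility of
    \<open>n\<close> by \<open>p\<close> is essential: \<open>X\<^sup>5 - X\<^sup>4 - 1\<close> has
    the factor \<open>X\<^sup>2 - X + 1\<close>.\<close>
  define y where "y = z ^ p"
  have y0: "y \<noteq> 0" using z(1) by (simp add: y_def)
  have 1: "y ^ m = y + 1" using z(3) by (simp add: y_def m power_mult)
  have 2: "inverse (y ^ m) = inverse y + 1"
    using z(4) by (simp add: y_def m power_mult power_inverse)
  have "y ^ m * inverse (y ^ m) = 1" using y0 by simp
  then have "(y + 1) * (inverse y + 1) = 1" unfolding 2 unfolding 1 .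
  then have "(y + 1) * (1 + y) = y" using y0 by (simp add: field_simps)
  then have sq: "y\<^sup>2 + y + 1 = 0" by (simp add: power2_eq_square algebra_simps)
  have "y ^ 3 - 1 = (y - 1) * (y\<^sup>2 + y + 1)" by (simp add: power2_eq_square power3_eq_cube algebra_simps)
  then have y3: "y ^ 3 = 1" using sq by simp
  have "y + 1 = - (y\<^sup>2)" using sq by (simp add: eq_neg_iff_add_eq_0 algebra_simps)
  then have "(y ^ m) ^ 3 = (- (y\<^sup>2)) ^ 3" using 1 by simp
  also have "\<dots> = - ((y ^ 3)\<^sup>2)" by (simp add: power2_eq_square power3_eq_cube)
  also have "\<dots> = -1" using y3 by simp
  also have "(y ^ m) ^ 3 = (y ^ 3) ^ m" by (simp add: mult.commute flip: power_mult)
  also have "\<dots> = 1" using y3 by simp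
  finally show False by simp
qed

lemma reflect_poly_of_int_poly:
  "map_poly of_int (reflect_poly h) = (reflect_poly (map_poly of_int h) :: complex poly)"
  by (rule poly_eqI) (simp add: coeff_map_poly coeff_reflect_poly)

text \<open>Thus \<open>k * reflect_poly k\<close> alone determines the sum of squares of the
  coefficients of \<open>k\<close>. For the trinomial it is 3, which leaves an integer polynomial
  with the same product at most three non-zero coefficients.\<close>

lemma coeff_mult_reflect_poly:
  fixes k :: "int poly"
  assumes "degree k = n"
  shows "coeff (k * reflect_poly k) n = (\<Sum>i\<le>n. (coeff k i)\<^sup>2)"
  unfolding coeff_mult
proof (rule sum.cong[OF refl])
  fix i assume "i \<in> {..n}"
  then show "coeff k i * coeff (reflect_poly k) (n - i) = (coeff k i)\<^sup>2"
    using assms by (simp add: coeff_reflect_poly power2_eq_square)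
qed

lemma sum_of_squares_eq_1:
  fixes c :: "nat \<Rightarrow> int"
  assumes "finite A" "(\<Sum>i\<in>A. (c i)\<^sup>2) = 1"
  shows "\<exists>j\<in>A. (c j)\<^sup>2 = 1 \<and> (\<forall>i\<in>A - {j}. c i = 0)"
proof -
  have "\<not> (\<forall>j\<in>A. c j = 0)"
  proof
    assume "\<forall>j\<in>A. c j = 0"
    then have "(\<Sum>i\<in>A. (c i)\<^sup>2) = 0" by (intro sum.neutral) simp
    then show False using assms(2) by simp
  qed
  then obtain j where j: "j \<in> A" "c j \<noteq> 0" by blast
  have split: "(\<Sum>i\<in>A. (c i)\<^sup>2) = (c j)\<^sup>2 + (\<Sum>i\<in>A - {j}. (c i)\<^sup>2)"
    by (rule sum.remove[OF assms(1) j(1)])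
  have "(c j)\<^sup>2 > 0" using j(2) by simp
  moreover have "(\<Sum>i\<in>A - {j}. (c i)\<^sup>2) \<ge> 0" by (intro sum_nonneg) simp
  ultimately have "(c j)\<^sup>2 = 1" "(\<Sum>i\<in>A - {j}. (c i)\<^sup>2) = 0" using split assms(2) by linarith+
  then have "\<forall>i\<in>A - {j}. c i = 0" using assms(1) by (simp add: sum_nonneg_eq_0_iff)
  then show ?thesis using j(1) \<open>(c j)\<^sup>2 = 1\<close> by blast
qed

text \<open>The end coefficients of \<open>k\<close> have product -1, so the sum of squares 3 leaves
  exactly one inner term \<open>t X\<^sup>j\<close>. Reversal turns \<open>U = X\<^sup>n - 1\<close>
  into \<open>- U\<close>; hence both products equal \<open>- U * U + X\<^sup>n\<close> plus a
  multiple of \<open>U\<close>. Cancelling \<open>U\<close> compares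
  \<open>X\<^sup>n\<^sup>-\<^sup>j - X\<^sup>j\<close> with
  \<open>X\<^sup>n\<^sup>-\<^sup>p - X\<^sup>p\<close> up to sign.\<close>

lemma reciprocal_square_trinomial:
  fixes k :: "int poly" and n p :: nat
  defines "f \<equiv> monom 1 n - monom 1 p - 1"
  assumes np: "0 < p" "p < n" and dk: "degree k = n" and k: "k * reflect_poly k = f * reflect_poly f"
  shows "k = f \<or> k = - f \<or> k = reflect_poly f \<or> k = - reflect_poly f"
proof -
  define U where "U = (monom 1 n - 1 :: int poly)"
  have cf: "coeff f i = (if i = n then 1 else if i = p \<or> i = 0 then -1 else 0)" for i
    using np by (auto simp: f_def)
  have df: "degree f = n"
  proof (rule antisym)
    show "degree f \<le> n" by (rule degree_le) (use np in \<open>simp add: cf\<close>)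
    show "n \<le> degree f" by (rule le_degree) (simp add: cf)
  qed
  have rf: "reflect_poly f = - U - monom 1 (n - p)"
    using np by (intro poly_eqI) (auto simp: coeff_reflect_poly cf df U_def)
  have f: "f = U - monom 1 p" by (simp add: f_def U_def)
  have "coeff (k * reflect_poly k) 0 = lead_coeff k * coeff k 0" by (simp add: coeff_mult_0)
  moreover have "coeff (f * reflect_poly f) 0 = -1" using np by (simp add: coeff_mult_0 cf df)
  ultimately have prod: "coeff k n * coeff k 0 = -1" using k dk by simp
  then have ends: "coeff k n = 1 \<and> coeff k 0 = -1 \<or> coeff k n = -1 \<and> coeff k 0 = 1"
    using zmult_eq_1_iff[of "coeff k n" "- coeff k 0"] by auto
  have split: "(\<Sum>i\<le>n. c i) = c 0 + c n + (\<Sum>i\<in>{0<..<n}. c i)" for c :: "nat \<Rightarrow> int"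
  proof -
    have "{..n} = insert 0 (insert n {0<..<n})" using np by auto
    then show ?thesis using np by simp
  qed
  have "(\<Sum>i\<le>n. (coeff k i)\<^sup>2) = (\<Sum>i\<le>n. (coeff f i)\<^sup>2)"
    using coeff_mult_reflect_poly[OF dk] coeff_mult_reflect_poly[OF df] k by simp
  also have "\<dots> = 3"
  proof -
    have "(\<Sum>i\<in>{0<..<n}. (coeff f i)\<^sup>2) = (\<Sum>i\<in>{0<..<n}. if i = p then 1 else 0)"
      by (intro sum.cong) (auto simp: cf)
    then show ?thesis using np by (simp add: split cf)
  qed
  finally have "(\<Sum>i\<in>{0<..<n}. (coeff k i)\<^sup>2) = 1" using ends by (auto simp: split)
  then obtain j where j: "j \<in> {0<..<n}" "(coeff k j)\<^sup>2 = 1" "\<forall>i\<in>{0<..<n} - {j}. coeff k i = 0"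
    using sum_of_squares_eq_1[of "{0<..<n}" "coeff k"] by blast
  define s t where "s = coeff k n" and "t = coeff k j"
  have s: "s = 1 \<or> s = -1" "coeff k 0 = - s" using ends by (auto simp: s_def)
  have t: "t = 1 \<or> t = -1" using j(2) by (simp add: t_def power2_eq_1_iff)
  have ck: "coeff k i = (if i = n then s else if i = 0 then - s else if i = j then t else 0)" for i
  proof -
    consider "i = 0" | "i = n" | "i = j" | "i > n" | "i \<in> {0<..<n} - {j}" by force
    then show ?thesis
      using j s(2) np dk by cases (auto simp: s_def t_def coeff_eq_0)
  qed
  have kk: "k = smult s U + smult t (monom 1 j)"
    using j(1) np by (intro poly_eqI) (auto simp: ck U_def)
  have rk: "reflect_poly k = - smult s U + smult t (monom 1 (n - j))"
    using j(1) np by (intro poly_eqI) (auto simp: coeff_reflect_poly ck dk U_def)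
  have VW: "monom 1 j * monom 1 (n - j) = (monom 1 n :: int poly)"
    "monom 1 p * monom 1 (n - p) = (monom 1 n :: int poly)"
    using j(1) np by (simp_all add: mult_monom)
  have "k * reflect_poly k = - (U * U) + smult (s * t) (U * (monom 1 (n - j) - monom 1 j)) + monom 1 n"
    unfolding rk unfolding kk VW(1)[symmetric] using s(1) t by (auto simp: algebra_simps)
  moreover have "f * reflect_poly f = - (U * U) - U * (monom 1 (n - p) - monom 1 p) + monom 1 n"
    unfolding rf unfolding f VW(2)[symmetric] by (simp add: algebra_simps)
  ultimately have "U * (smult (s * t) (monom 1 (n - j) - monom 1 j) + (monom 1 (n - p) - monom 1 p)) = 0"
    using k by (simp add: algebra_simps)
  moreover have "coeff U n = 1" using np by (simp add: U_def)
  then have "U \<noteq> 0" by auto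
  ultimately have zero: "smult (s * t) (monom 1 (n - j) - monom 1 j) + (monom 1 (n - p) - monom 1 p) = (0 :: int poly)"
    by (simp only: mult_eq_0_iff) simp
  have eq: "s * t * ((if n - j = i then 1 else 0) - (if j = i then 1 else 0))
      + ((if n - p = i then 1 else 0) - (if p = i then 1 else 0)) = (0::int)" for i
  proof -
    have "coeff (smult (s * t) (monom 1 (n - j) - monom 1 j) + (monom 1 (n - p) - monom 1 p)) i = coeff 0 i"
      unfolding zero ..
    then show ?thesis by simp
  qed
  have "j = p \<and> t = - s \<or> j = n - p \<and> t = s"
  \<comment> \<open>For \<open>n = 2 * p\<close> the two monomials of \<open>f\<close> cancel and
    the equation says nothing about the sign of \<open>t\<close>. But then
    \<open>j = p = n - p\<close>, and each sign of \<open>t\<close> belongs to one of the two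
    alternatives.\<close>
  proof (cases "n = 2 * p")
    case True
    then have "n - p = p" by simp
    then have "n - j = j" using eq[of j] s(1) t by (auto split: if_splits)
    then show ?thesis using True j(1) s(1) t by auto
  next
    case False
    then have "n - p \<noteq> p" using np by auto
    then show ?thesis using eq[of p] s(1) t j(1) np by (auto split: if_splits)
  qed
  then show ?thesis
  proof
    assume "j = p \<and> t = - s"
    then have "k = smult s f" unfolding kk f by (simp add: smult_diff_right)
    then show ?thesis using s(1) by auto
  next
    assume "j = n - p \<and> t = s"
    then have "k = smult (- s) (reflect_poly f)" unfolding kk rf by (simp add: smult_diff_right)
    then show ?thesis using s(1) by auto
  qed
qed

text \<open>Ljunggren's trick: from \<open>f = g * h\<close> form \<open>k = g * h\<^sup>*\<close>, where \<open>*\<close> denotes the reciprocal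
  polynomial; then \<open>k * k\<^sup>* = f * f\<^sup>*\<close> forces \<open>k\<close> to be \<open>f\<close> or \<open>f\<^sup>*\<close> up to sign, so that one of
  \<open>g\<close> and \<open>h\<close> is self-reciprocal up to sign and \<open>f\<close> has two mutually inverse roots.\<close>

lemma irreducible_trinomial:
  assumes np: "0 < p" "p < n" "p dvd n"
  shows "irreducible_over_rat (monom 1 n - monom 1 p - 1)"
proof -
  define f where "f = (monom 1 n - monom 1 p - 1 :: int poly)"
  have cf: "coeff f i = (if i = n then 1 else if i = p \<or> i = 0 then -1 else 0)" for i
    using np by (auto simp: f_def)
  have df: "degree f = n"
  proof (rule antisym)
    show "degree f \<le> n" by (rule degree_le) (use np in \<open>simp add: cf\<close>)
    show "n \<le> degree f" by (rule le_degree) (simp add: cf)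
  qed
  have ev: "poly (map_poly of_int f) z = z ^ n - z ^ p - 1" for z :: complex
    by (simp add: f_def of_int_poly_hom.hom_minus poly_monom)
  have no_self_reciprocal: False
    if q: "q dvd f" "degree q > 0" and r: "reflect_poly q = q \<or> reflect_poly q = - q" for q :: "int poly"
  proof -
    have "\<not> constant (poly (map_poly of_int q :: complex poly))" using q(2) by (simp add: constant_degree)
    then obtain z :: complex where z: "poly (map_poly of_int q) z = 0" using fundamental_theorem_of_algebra by blast
    obtain w where w: "f = q * w" using q(1) by (elim dvdE)
    have root: "poly (map_poly of_int f) u = 0" if "poly (map_poly of_int q) u = 0" for u :: complex
      unfolding w using that by (simp add: of_int_poly_hom.hom_mult)
    have fz: "z ^ n - z ^ p - 1 = 0" using root[OF z] by (simp add: ev)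
    then have z0: "z \<noteq> 0" using np by (auto simp: power_0_left)
    have "poly (map_poly of_int (reflect_poly q)) z = 0"
      using r z by (auto simp: of_int_poly_hom.hom_uminus)
    then have "poly (map_poly of_int q) (inverse z) = 0"
      unfolding reflect_poly_of_int_poly using z0 by (simp add: poly_reflect_poly_nz)
    from root[OF this] have "inverse z ^ n - inverse z ^ p - 1 = 0" by (simp add: ev)
    then show False using fz
      by (intro trinomial_no_reciprocal_root[OF z0 np(3)]) (simp_all add: algebra_simps)
  qed
  have "irreducible_over_rat f"
  proof (rule irreducible_over_ratI)
    show "degree f > 0" using df np by simp
    fix g h assume gh: "f = g * h" "degree g > 0" "degree h > 0"
    have "coeff g 0 * coeff h 0 = -1" using np by (simp add: cf flip: coeff_mult_0 gh(1))
    \<comment> \<open>With non-zero constant coefficients, reversal preserves degrees and is an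
      involution on \<open>g\<close> and \<open>h\<close>.\<close>
    then have c0: "coeff g 0 \<noteq> 0" "coeff h 0 \<noteq> 0" by auto
    have gh0: "g \<noteq> 0" "h \<noteq> 0" using gh by auto
    define k where "k = g * reflect_poly h"
    have "degree k = degree g + degree h"
      unfolding k_def using gh0 c0 by (simp add: degree_mult_eq)
    then have dk: "degree k = n" using df gh gh0 by (simp add: degree_mult_eq)
    have "k * reflect_poly k = f * reflect_poly f"
      using c0 by (simp add: k_def gh(1) reflect_poly_mult mult_ac)
    from reciprocal_square_trinomial[OF np(1,2) dk this[unfolded f_def]]
    have "k = f \<or> k = - f \<or> k = reflect_poly f \<or> k = - reflect_poly f" by (simp add: f_def)
    moreover have "k = f \<or> k = - f \<Longrightarrow> reflect_poly h = h \<or> reflect_poly h = - h"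
    proof -
      assume "k = f \<or> k = - f"
      then have "g * reflect_poly h = g * h \<or> g * reflect_poly h = g * (- h)" by (simp add: k_def gh(1))
      then show ?thesis using gh0(1) by (simp only: mult_cancel_left) auto
    qed
    moreover have "k = reflect_poly f \<or> k = - reflect_poly f \<Longrightarrow> reflect_poly g = g \<or> reflect_poly g = - g"
    proof -
      assume "k = reflect_poly f \<or> k = - reflect_poly f"
      then have "g * reflect_poly h = reflect_poly g * reflect_poly h
          \<or> g * reflect_poly h = (- reflect_poly g) * reflect_poly h"
        by (simp add: k_def gh(1) reflect_poly_mult)
      moreover have "reflect_poly h \<noteq> 0" using gh0 by simp
      ultimately have "g = reflect_poly g \<or> g = - reflect_poly g" by (simp only: mult_cancel_right) auto
      then show ?thesis by (metis minus_equation_iff)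
    qed
    moreover have "g dvd f" "h dvd f" using gh(1) by auto
    ultimately show False using no_self_reciprocal gh(2,3) by blast
  qed
  then show ?thesis by (simp add: f_def)
qed


lemma irreducible_X2_plus_1: "irreducible_over_rat [:1, 0, 1:]"
proof (rule irreducible_over_ratI)
  fix g h :: "int poly" assume f: "[:1, 0, 1:] = g * h" and d: "degree g > 0" "degree h > 0"
  have "g \<noteq> 0" "h \<noteq> 0" using d by auto
  then have "degree g + degree h = 2" using degree_mult_eq[of g h] by (simp flip: f)
  then have d1: "degree g = 1" "degree h = 1" using d by auto
  have lin: "q = [:coeff q 0, coeff q 1:]" if "degree q = 1" for q :: "int poly"
    using that by (intro poly_eqI) (auto simp: coeff_pCons coeff_eq_0 split: nat.splits)
  obtain a b a' b' where g: "g = [:a, b:]" and h: "h = [:a', b':]"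
    using lin[OF d1(1)] lin[OF d1(2)] by blast
  \<comment> \<open>Integer units are their own inverses, so \<open>a' = a\<close> and
    \<open>b' = b\<close>, and the middle coefficient would be 2 or -2.\<close>
  have "a * a' = 1" "b * b' = 1" "a * b' + b * a' = 0" using f by (auto simp: g h mult.commute add.commute)
  then show False by (auto simp: zmult_eq_1_iff)
qed simp

text \<open>Eisenstein's criterion cannot apply directly when all coefficients are -1, 0 or 1, so
  explicit polynomials take its place. For composite \<open>n\<close> the least prime divisor
  \<open>p\<close> is less than \<open>n\<close>, and the trinomial is
  \<open>X\<^sup>m - X - 1\<close> with \<open>m > 1\<close>, evaluated at
  \<open>X\<^sup>p\<close>.\<close>

lemma I_star_1_pos:
  assumes n: "n \<ge> 2" and np: "\<not> (prime n \<and> odd n)"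
  shows "I_star n 1 > 0"
proof -
  have "\<exists>f. f \<in> S_star n 1 \<and> irreducible_over_rat f"
  proof (cases "prime n")
    case True
    then have n2: "n = 2" using np primes_dvd_imp_eq two_is_prime_nat by blast
    have "[:1, 0, 1:] = pcompose [:1, 1::int:] (monom 1 2)"
      by (rule poly_eqI) (simp add: pcompose_pCons coeff_pCons numeral_2_eq_2 split: nat.splits)
    then have "degenerate (map_poly of_int [:1, 0, 1:])"
      using degenerate_pcompose_monom[of 2 "[:1, 1:]"] by simp
    then have "[:1, 0, 1:] \<in> S_star n 1"
      by (auto simp: S_star_def n2 coeff_pCons numeral_2_eq_2 split: nat.splits)
    then show ?thesis using irreducible_X2_plus_1 by blast
  next
    case False
    define p where "p = (LEAST q. prime q \<and> q dvd n)"
    have p: "prime p" "p dvd n" using least_prime_divisor[OF n p_def] by auto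
    then have p2: "p \<ge> 2" by (simp add: prime_ge_2_nat)
    have "p \<le> n" using p(2) n by (intro dvd_imp_le) auto
    moreover have "p \<noteq> n" using p(1) False by blast
    ultimately have pn: "p < n" by simp
    obtain m where m: "n = p * m" using p(2) by (elim dvdE)
    have m1: "m > 1" using m pn by (cases m) auto
    define f where "f = (monom 1 n - monom 1 p - 1 :: int poly)"
    define g where "g = (monom 1 m - monom 1 1 - 1 :: int poly)"
    have "f = pcompose g (monom 1 p)"
    proof (rule poly_eqI)
      fix i
      have eq: "coeff (pcompose g (monom 1 p)) i = (if p dvd i then coeff g (i div p) else 0)"
        using p2 by (intro coeff_pcompose_monom) auto
      show "coeff f i = coeff (pcompose g (monom 1 p)) i"
      proof (cases "p dvd i")
        case True
        then obtain j where j: "i = p * j" by (elim dvdE)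
        show ?thesis unfolding eq using p2 m1 by (simp add: f_def g_def j m)
      next
        case False
        have "i \<noteq> 0" using False by (metis dvd_0_right)
        moreover have "i \<noteq> n" "i \<noteq> p" using False p(2) by auto
        ultimately show ?thesis unfolding eq using False by (simp add: f_def)
      qed
    qed
    moreover have "coeff g m = 1" using m1 by (simp add: g_def)
    then have "degree g > 0" using m1 le_degree[of g m] by simp
    moreover have "coeff g 0 \<noteq> 0" using m1 by (simp add: g_def)
    ultimately have dg: "degenerate (map_poly of_int f)" using degenerate_pcompose_monom p2 by simp
    have cf: "coeff f i = (if i = n then 1 else if i = p \<or> i = 0 then -1 else 0)" for i
      using pn p2 by (auto simp: f_def)
    have df: "degree f = n"
    proof (rule antisym)
      show "degree f \<le> n" by (rule degree_le) (use pn in \<open>simp add: cf\<close>)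
      show "n \<le> degree f" by (rule le_degree) (simp add: cf)
    qed
    have "f \<in> S_star n 1" using dg df by (simp add: S_star_def cf)
    moreover have "irreducible_over_rat f"
      unfolding f_def using p2 pn p(2) by (intro irreducible_trinomial) auto
    ultimately show ?thesis by blast
  qed
  then have "{f \<in> S_star n 1. irreducible_over_rat f} \<noteq> {}" by blast
  then show ?thesis using finite_S_star[of n 1] by (simp add: I_star_def card_gt_0_iff)
qed

lemma I_star_lower_bound:
  fixes n p H :: nat
  assumes n: "n \<ge> 2" and p: "p = (LEAST q. prime q \<and> q dvd n)" and H: "H \<ge> 1"
    and ex: "\<not> (H = 1 \<and> prime n \<and> odd n)"
  shows "(1 / 8) ^ Suc (n div p) * real H powr (1 + real n / real p) \<le> real (I_star n H)"
proof (cases "H = 1")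
  case True
  then have "I_star n H > 0" using I_star_1_pos[OF n] ex by simp
  then have "1 \<le> real (I_star n H)" by simp
  moreover have "(1 / 8 :: real) ^ Suc (n div p) \<le> 1" by (rule power_le_one) auto
  ultimately show ?thesis using True by simp
next
  case False
  then have H2: "H \<ge> 2" using H by simp
  define K where "K = (H + 2) div 4"
  \<comment> \<open>From \<open>H + 2 \<le> 4 * K + 3\<close> and \<open>K \<ge> 1\<close> even
    \<open>H \<le> 5 * K\<close> follows; the 8 is generous. For \<open>H = 1\<close> one has
    \<open>K = 0\<close>, so that case needs the separate argument.\<close>
  have "H \<le> 8 * K" using H2 unfolding K_def by presburger
  then have "real H / 8 \<le> real K" by linarith
  then have "(real H / 8) ^ Suc (n div p) \<le> real K ^ Suc (n div p)" by (rule power_mono) simp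
  also have "\<dots> = real (K ^ Suc (n div p))" by simp
  also have "\<dots> \<le> real (I_star n H)"
    unfolding K_def by (rule of_nat_mono[OF I_star_lower_bound_ge_2[OF n p H2]])
  finally show ?thesis unfolding powr_one_plus_quotient[OF n p H] by (simp add: power_divide)
qed

theorem theorem5p1:
  fixes n p :: nat
  assumes "n \<ge> 2"
    and "p = (LEAST q. prime q \<and> q dvd n)"
  shows "\<exists>c C :: real. c > 0 \<and> C > 0 \<and>
           (\<forall>H::nat. H \<ge> 1 \<longrightarrow>
              (\<not> (H = 1 \<and> prime n \<and> odd n) \<longrightarrow>
                 c * real H powr (1 + real n / real p) \<le> real (I_star n H)) \<and>
              real (I_star n H) \<le> C * real H powr (1 + real n / real p))"
proof -
  obtain C :: real where C: "C > 0" "\<forall>H\<ge>1. real (I_star n H) \<le> C * real H powr (1 + real n / real p)"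
    using I_star_upper_bound[OF assms] by blast
  show ?thesis
  proof (intro exI conjI allI impI)
    show "(1 / 8 :: real) ^ Suc (n div p) > 0" by simp
    show "C > 0" by (rule C(1))
    fix H :: nat assume H: "H \<ge> 1"
    show "real (I_star n H) \<le> C * real H powr (1 + real n / real p)" using C(2) H by blast
    assume "\<not> (H = 1 \<and> prime n \<and> odd n)"
    then show "(1 / 8) ^ Suc (n div p) * real H powr (1 + real n / real p) \<le> real (I_star n H)"
      by (rule I_star_lower_bound[OF assms H])
  qed
qed

end
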